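(* Let $F_Y$ be the free group on a finite set $Y$ of generators, and let $H\le K\le F_Y$ be finitely generated subgroups. Then there is a basis $B$ of $F_Y$ such that the morphism of core graphs (Stallings graphs) $\Gamma_B(H)\to\Gamma_B(K)$ is onto. Moreover, this basis can be obtained by conjugation, i.e. $B$ can be taken of the form $gYg^{-1}=\{gyg^{-1} : y\in Y\}$ for some $g\in F_Y$.
   Context: Graphs are in the sense of Serre: a graph $\Gamma$ has a vertex set $V(\Gamma)$, an edge set $E(\Gamma)$, an initial vertex map $\iota:E(\Gamma)\to V(\Gamma)$ and an involution $e\mapsto\overline e$ on $E(\Gamma)$ with $\overline e\ne e$. A graph morphism is a pair of maps on vertices and edges commuting with $\iota$ and the involution; it is onto if it is surjective on vertices and on edges. A path is a finite sequence of edges $e_1,\dots,e_n$ with $\iota(\overline{e_k})=\iota(e_{k+1})$; it is closed if $\iota(\overline{e_n})=\iota(e_1)$, and reduced if $e_{k+1}\neq\overline{e_k}$ for all $k$. Graphs are assumed connected. For a set $B$, a $B$-labeled graph is a graph with a label map $l:E(\Gamma)\to B\cup B^{-1}$ satisfying $l(\overline e)=l(e)^{-1}$; the label of a path $e_1,\dots,e_n$ is $l(e_1)\cdots l(e_n)$ in the free group on $B$. A pointed labeled graph has a distinguished base point; morphisms of pointed labeled graphs preserve labels and base points. For a pointed $B$-labeled graph, $\pi_1(\Gamma)$ denotes the set of labels of closed paths starting at the base point; it is a subgroup of the free group on $B$. A labeled graph is folded if distinct edges with the same initial vertex have distinct labels. A core graph is a connected pointed folded labeled graph in which every edge belongs to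 a closed reduced path starting at the base point. Given a basis $B$ of a free group $F$ (so $F$ is identified with the free group on $B$) and a subgroup $H\le F$, $\Gamma_B(H)$ is the $B$-labeled core graph, unique up to unique isomorphism, with $\pi_1(\Gamma_B(H))=H$. If $H\le K\le F$, there is a unique morphism of pointed $B$-labeled graphs $\Gamma_B(H)\to\Gamma_B(K)$.
   Formalization: The case of H trivial and K nontrivial is excluded, since there the claim fails for every basis B: the core graph of the trivial subgroup is a single vertex without edges, while that of K has an edge. *)

theory Defs
  imports "HOL-Algebra.Generated_Groups"
begin

section \<open>Free groups and bases\<close>

text \<open>The letter \<open>(a, True)\<close> stands for the generator \<open>a\<close> and \<open>(a, False)\<close> for its formal
  inverse.\<close>

type_synonym 'a letter = "'a \<times> bool"

definition letter_inv :: "'a letter \<Rightarrow> 'a letter" where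
  "letter_inv x = (fst x, \<not> snd x)"

definition reduced_word :: "'a letter list \<Rightarrow> bool" where
  "reduced_word w \<longleftrightarrow> successively (\<lambda>x y. y \<noteq> letter_inv x) w"

fun push_letter :: "'a letter \<Rightarrow> 'a letter list \<Rightarrow> 'a letter list" where
  "push_letter x [] = [x]"
| "push_letter x (y # w) = (if y = letter_inv x then w else x # y # w)"

definition reduce_word :: "'a letter list \<Rightarrow> 'a letter list" where
  "reduce_word w = foldr push_letter w []"

definition free_group :: "'a set \<Rightarrow> 'a letter list monoid" where
  "free_group A =
     \<lparr>carrier = {w. fst ` set w \<subseteq> A \<and> reduced_word w},
      mult = (\<lambda>u v. reduce_word (u @ v)),
      one = []\<rparr>"

definition word_eval :: "('g, 'm) monoid_scheme \<Rightarrow> 'g letter list \<Rightarrow> 'g" where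
  "word_eval F w =
     foldr (\<lambda>(b, s) x. (if s then b else inv\<^bsub>F\<^esub> b) \<otimes>\<^bsub>F\<^esub> x) w \<one>\<^bsub>F\<^esub>"

definition free_basis :: "('g, 'm) monoid_scheme \<Rightarrow> 'g set \<Rightarrow> bool" where
  "free_basis F B \<longleftrightarrow> B \<subseteq> carrier F \<and> word_eval F \<in> iso (free_group B) F"

definition finitely_generated :: "('g, 'm) monoid_scheme \<Rightarrow> 'g set \<Rightarrow> bool" where
  "finitely_generated F H \<longleftrightarrow> (\<exists>S. finite S \<and> S \<subseteq> carrier F \<and> H = generate F S)"


section \<open>Graphs in the sense of Serre\<close>

record ('v, 'e) sgraph =
  verts :: "'v set"
  edges :: "'e set"
  origin :: "'e \<Rightarrow> 'v"
  opposite :: "'e \<Rightarrow> 'e"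

definition serre_graph :: "('v, 'e, 'm) sgraph_scheme \<Rightarrow> bool" where
  "serre_graph \<Gamma> \<longleftrightarrow>
     (\<forall>e \<in> edges \<Gamma>. origin \<Gamma> e \<in> verts \<Gamma> \<and> opposite \<Gamma> e \<in> edges \<Gamma> \<and>
        opposite \<Gamma> (opposite \<Gamma> e) = e \<and> opposite \<Gamma> e \<noteq> e)"

text \<open>\<open>is_path \<Gamma> u p v\<close>: the edge sequence \<open>p\<close> is a path from \<open>u\<close> to \<open>v\<close>.  The empty sequence is
  a closed path at every vertex.\<close>

fun is_path :: "('v, 'e, 'm) sgraph_scheme \<Rightarrow> 'v \<Rightarrow> 'e list \<Rightarrow> 'v \<Rightarrow> bool" where
  "is_path \<Gamma> u [] v \<longleftrightarrow> u \<in> verts \<Gamma> \<and> u = v"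
| "is_path \<Gamma> u (e # p) v \<longleftrightarrow>
     e \<in> edges \<Gamma> \<and> origin \<Gamma> e = u \<and> is_path \<Gamma> (origin \<Gamma> (opposite \<Gamma> e)) p v"

definition reduced_path :: "('v, 'e, 'm) sgraph_scheme \<Rightarrow> 'e list \<Rightarrow> bool" where
  "reduced_path \<Gamma> p \<longleftrightarrow> successively (\<lambda>e e'. e' \<noteq> opposite \<Gamma> e) p"

definition connected_graph :: "('v, 'e, 'm) sgraph_scheme \<Rightarrow> bool" where
  "connected_graph \<Gamma> \<longleftrightarrow>
     verts \<Gamma> \<noteq> {} \<and> (\<forall>u \<in> verts \<Gamma>. \<forall>v \<in> verts \<Gamma>. \<exists>p. is_path \<Gamma> u p v)"


section \<open>Pointed labeled graphs and core graphs\<close>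

text \<open>Since the ambient group \<open>F\<close> is identified with the free group on its basis \<open>B\<close>, the label
  alphabet, consisting of \<open>B\<close> and the inverses of its elements, is taken inside \<open>F\<close>, and labels of
  paths are evaluated in \<open>F\<close>.\<close>

record ('v, 'e, 'g) pl_graph = "('v, 'e) sgraph" +
  basepoint :: 'v
  label :: "'e \<Rightarrow> 'g"

definition pointed_labeled_graph ::
    "('g, 'm) monoid_scheme \<Rightarrow> 'g set \<Rightarrow> ('v, 'e, 'g) pl_graph \<Rightarrow> bool" where
  "pointed_labeled_graph F B \<Gamma> \<longleftrightarrow>
     serre_graph \<Gamma> \<and> basepoint \<Gamma> \<in> verts \<Gamma> \<and>
     (\<forall>e \<in> edges \<Gamma>. label \<Gamma> e \<in> B \<union> (\<lambda>b. inv\<^bsub>F\<^esub> b) ` B \<and>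
        label \<Gamma> (opposite \<Gamma> e) = inv\<^bsub>F\<^esub> (label \<Gamma> e))"

definition path_label ::
    "('g, 'm) monoid_scheme \<Rightarrow> ('v, 'e, 'g) pl_graph \<Rightarrow> 'e list \<Rightarrow> 'g" where
  "path_label F \<Gamma> p = foldr (\<lambda>e x. label \<Gamma> e \<otimes>\<^bsub>F\<^esub> x) p \<one>\<^bsub>F\<^esub>"

definition pi1 :: "('g, 'm) monoid_scheme \<Rightarrow> ('v, 'e, 'g) pl_graph \<Rightarrow> 'g set" where
  "pi1 F \<Gamma> = {path_label F \<Gamma> p | p. is_path \<Gamma> (basepoint \<Gamma>) p (basepoint \<Gamma>)}"

definition folded :: "('v, 'e, 'g) pl_graph \<Rightarrow> bool" where
  "folded \<Gamma> \<longleftrightarrow>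
     (\<forall>e \<in> edges \<Gamma>. \<forall>e' \<in> edges \<Gamma>.
        e \<noteq> e' \<and> origin \<Gamma> e = origin \<Gamma> e' \<longrightarrow> label \<Gamma> e \<noteq> label \<Gamma> e')"

definition core_graph ::
    "('g, 'm) monoid_scheme \<Rightarrow> 'g set \<Rightarrow> ('v, 'e, 'g) pl_graph \<Rightarrow> bool" where
  "core_graph F B \<Gamma> \<longleftrightarrow>
     pointed_labeled_graph F B \<Gamma> \<and> connected_graph \<Gamma> \<and> folded \<Gamma> \<and>
     (\<forall>e \<in> edges \<Gamma>. \<exists>p. is_path \<Gamma> (basepoint \<Gamma>) p (basepoint \<Gamma>) \<and>
        reduced_path \<Gamma> p \<and> e \<in> set p)"

text \<open>\<open>stallings_graph F B H \<Gamma>\<close>: \<open>\<Gamma>\<close> is (a representative of the isomorphism class of)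
  \<open>\<Gamma>\<^sub>B(H)\<close>.\<close>

definition stallings_graph ::
    "('g, 'm) monoid_scheme \<Rightarrow> 'g set \<Rightarrow> 'g set \<Rightarrow> ('v, 'e, 'g) pl_graph \<Rightarrow> bool" where
  "stallings_graph F B H \<Gamma> \<longleftrightarrow> core_graph F B \<Gamma> \<and> pi1 F \<Gamma> = H"

definition pl_morphism ::
    "('v, 'e, 'g) pl_graph \<Rightarrow> ('w, 'd, 'g) pl_graph \<Rightarrow> ('v \<Rightarrow> 'w) \<Rightarrow> ('e \<Rightarrow> 'd) \<Rightarrow> bool" where
  "pl_morphism \<Gamma> \<Delta> \<phi> \<psi> \<longleftrightarrow>
     \<phi> ` verts \<Gamma> \<subseteq> verts \<Delta> \<and> \<psi> ` edges \<Gamma> \<subseteq> edges \<Delta> \<and>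
     (\<forall>e \<in> edges \<Gamma>. origin \<Delta> (\<psi> e) = \<phi> (origin \<Gamma> e) \<and>
        opposite \<Delta> (\<psi> e) = \<psi> (opposite \<Gamma> e) \<and> label \<Delta> (\<psi> e) = label \<Gamma> e) \<and>
     \<phi> (basepoint \<Gamma>) = basepoint \<Delta>"

definition onto_morphism ::
    "('v, 'e, 'g) pl_graph \<Rightarrow> ('w, 'd, 'g) pl_graph \<Rightarrow> ('v \<Rightarrow> 'w) \<Rightarrow> ('e \<Rightarrow> 'd) \<Rightarrow> bool" where
  "onto_morphism \<Gamma> \<Delta> \<phi> \<psi> \<longleftrightarrow> \<phi> ` verts \<Gamma> = verts \<Delta> \<and> \<psi> ` edges \<Gamma> = edges \<Delta>"


section \<open>Consistency: the group of reduced words is free on its letters\<close>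

lemma letter_inv_invol [simp]: "letter_inv (letter_inv x) = x"
  by (simp add: letter_inv_def)

lemma letter_inv_neq [simp]: "letter_inv x \<noteq> x" "x \<noteq> letter_inv x"
  by (auto simp: letter_inv_def prod_eq_iff)

lemma fst_letter_inv [simp]: "fst (letter_inv x) = fst x"
  by (simp add: letter_inv_def)

lemma reduced_push: "reduced_word w \<Longrightarrow> reduced_word (push_letter x w)"
  by (cases w) (auto simp: reduced_word_def successively_Cons)

lemma push_cancel: "reduced_word w \<Longrightarrow> push_letter x (push_letter (letter_inv x) w) = w"
proof (cases w)
  case (Cons y v)
  assume "reduced_word w"
  with Cons show ?thesis
    by (cases v) (auto simp: reduced_word_def)
qed simp

lemma reduced_foldr_push: "reduced_word w \<Longrightarrow> reduced_word (foldr push_letter u w)"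
  by (induction u) (auto intro: reduced_push)

lemma reduced_reduce: "reduced_word (reduce_word w)"
  unfolding reduce_word_def by (rule reduced_foldr_push) (simp add: reduced_word_def)

lemma reduce_id: "reduced_word w \<Longrightarrow> reduce_word w = w"
proof (induction w)
  case (Cons x w)
  then have "reduce_word w = w" by (auto simp: reduced_word_def successively_Cons)
  with Cons.prems show ?case
    by (cases w) (auto simp: reduce_word_def reduced_word_def)
qed (simp add: reduce_word_def)

lemma foldr_push_push:
  assumes "reduced_word w"
  shows "foldr push_letter (push_letter x v) w = push_letter x (foldr push_letter v w)"
proof (cases v)
  case (Cons y u)
  then show ?thesis
    using push_cancel[OF reduced_foldr_push[OF assms]] by auto
qed simp

lemma foldr_push_reduce:
  assumes "reduced_word w"
  shows "foldr push_letter (reduce_word u) w = foldr push_letter u w"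
  by (induction u) (simp_all add: reduce_word_def foldr_push_push[OF assms])

lemma reduce_append_left: "reduce_word (reduce_word u @ v) = reduce_word (u @ v)"
  using foldr_push_reduce[OF reduced_reduce[of v], of u] by (simp add: reduce_word_def)

lemma reduce_append_right: "reduce_word (u @ reduce_word v) = reduce_word (u @ v)"
  using reduce_id[OF reduced_reduce[of v]] by (simp add: reduce_word_def)

lemma set_push: "set (push_letter x w) \<subseteq> insert x (set w)"
  by (cases w) auto

lemma set_reduce: "set (reduce_word w) \<subseteq> set w"
proof (induction w)
  case (Cons x w)
  then show ?case using set_push[of x "reduce_word w"] by (auto simp: reduce_word_def)
qed (simp add: reduce_word_def)

lemma foldr_push_inverse:
  "reduced_word w \<Longrightarrow> foldr push_letter (map letter_inv (rev u)) (foldr push_letter u w) = w"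
proof (induction u)
  case (Cons x u)
  then show ?case
    using push_cancel[OF reduced_foldr_push[OF Cons.prems], of "letter_inv x" u] by simp
qed simp

lemma group_free_group: "group (free_group A)"
proof (rule groupI)
  fix u v assume "u \<in> carrier (free_group A)" "v \<in> carrier (free_group A)"
  then show "u \<otimes>\<^bsub>free_group A\<^esub> v \<in> carrier (free_group A)"
    using set_reduce[of "u @ v"] reduced_reduce[of "u @ v"] by (force simp: free_group_def)
next
  fix u v w
  show "u \<otimes>\<^bsub>free_group A\<^esub> v \<otimes>\<^bsub>free_group A\<^esub> w = u \<otimes>\<^bsub>free_group A\<^esub> (v \<otimes>\<^bsub>free_group A\<^esub> w)"
    by (simp add: free_group_def reduce_append_left reduce_append_right)
next
  fix u assume u: "u \<in> carrier (free_group A)"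
  let ?i = "reduce_word (map letter_inv (rev u))"
  have "set ?i \<subseteq> letter_inv ` set u"
    using set_reduce[of "map letter_inv (rev u)"] by simp
  then have "?i \<in> carrier (free_group A)"
    using u reduced_reduce[of "map letter_inv (rev u)"] by (force simp: free_group_def)
  moreover have "?i \<otimes>\<^bsub>free_group A\<^esub> u = \<one>\<^bsub>free_group A\<^esub>"
    using foldr_push_inverse[of "[]" u]
    by (simp add: free_group_def reduce_append_left) (simp add: reduce_word_def reduced_word_def)
  ultimately show "\<exists>y \<in> carrier (free_group A). y \<otimes>\<^bsub>free_group A\<^esub> u = \<one>\<^bsub>free_group A\<^esub>"
    by blast
qed (auto simp: free_group_def reduced_word_def reduce_id)

abbreviation free_gen :: "'a \<Rightarrow> 'a letter list" where
  "free_gen a \<equiv> [(a, True)]"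

lemma inv_free_gen: "a \<in> A \<Longrightarrow> inv\<^bsub>free_group A\<^esub> (free_gen a) = [(a, False)]"
  by (rule group.inv_equality[OF group_free_group])
     (auto simp: free_group_def reduced_word_def reduce_word_def letter_inv_def)

lemma word_eval_free_gen:
  assumes "fst ` set w \<subseteq> free_gen ` A"
  shows "word_eval (free_group A) w = reduce_word (map (\<lambda>(b, s). (fst (hd b), s)) w)"
  using assms
proof (induction w)
  case Nil
  then show ?case by (simp add: word_eval_def free_group_def reduce_word_def)
next
  case (Cons x w)
  obtain a s where x: "x = (free_gen a, s)" and a: "a \<in> A"
    using Cons.prems by (cases x) auto
  have "word_eval (free_group A) (x # w) =
          [(a, s)] \<otimes>\<^bsub>free_group A\<^esub> word_eval (free_group A) w"
    using a by (auto simp: word_eval_def x inv_free_gen)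
  also have "word_eval (free_group A) w = reduce_word (map (\<lambda>(b, s). (fst (hd b), s)) w)"
    using Cons by simp
  finally show ?case
    using reduce_append_right[of "[(a, s)]" "map (\<lambda>(b, s). (fst (hd b), s)) w"]
    by (simp add: x free_group_def)
qed

theorem free_basis_free_group: "free_basis (free_group A) (free_gen ` A)"
proof -
  let ?m = "map (\<lambda>(b, s). (fst (hd b), s)) :: 'a letter list letter list \<Rightarrow> 'a letter list"
  let ?n = "map (\<lambda>(a, s). (free_gen a, s)) :: 'a letter list \<Rightarrow> 'a letter list letter list"
  let ?F = "free_group A" and ?G = "free_group (free_gen ` A)"
  have nm: "?n (?m w) = w" if "fst ` set w \<subseteq> free_gen ` A" for w
    using that by (induction w) auto
  have mn: "?m (?n w) = w" for w
    by (induction w) auto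
  have red_n: "reduced_word (?n w) \<longleftrightarrow> reduced_word w" for w
    by (auto simp: reduced_word_def successively_map letter_inv_def split_def prod_eq_iff)
  have push_n: "?n (push_letter x w) = push_letter ((\<lambda>(a, s). (free_gen a, s)) x) (?n w)" for x w
    by (cases w) (auto simp: letter_inv_def split_def prod_eq_iff)
  have reduce_n: "?n (reduce_word w) = reduce_word (?n w)" for w
    by (induction w) (simp_all add: reduce_word_def push_n)
  have fst_n: "fst ` set (?n w) = free_gen ` fst ` set w" for w
    by (induction w) auto
  have carrG: "carrier ?G = ?n ` carrier ?F"
  proof
    show "carrier ?G \<subseteq> ?n ` carrier ?F"
    proof
      fix w assume w: "w \<in> carrier ?G"
      then have sub: "fst ` set w \<subseteq> free_gen ` A" and "reduced_word w"
        by (auto simp: free_group_def)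
      then have "reduced_word (?m w)" using red_n[of "?m w"] nm[OF sub] by simp
      moreover have "fst ` set (?m w) \<subseteq> A" using sub by fastforce
      ultimately have "?m w \<in> carrier ?F" by (simp add: free_group_def)
      with nm[OF sub, symmetric] show "w \<in> ?n ` carrier ?F" by (rule image_eqI)
    qed
    show "?n ` carrier ?F \<subseteq> carrier ?G"
    proof
      fix w assume "w \<in> ?n ` carrier ?F"
      then obtain v where v: "w = ?n v" "fst ` set v \<subseteq> A" "reduced_word v"
        unfolding free_group_def by auto
      have "fst ` set w \<subseteq> free_gen ` A"
        unfolding v(1) fst_n using v(2) by (rule image_mono)
      moreover have "reduced_word w"
        unfolding v(1) red_n by (rule v(3))
      ultimately show "w \<in> carrier ?G" by (simp add: free_group_def)
    qed
  qed
  have ev: "word_eval ?F (?n w) = w" if "w \<in> carrier ?F" for w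
  proof -
    have "fst ` set w \<subseteq> A" and red: "reduced_word w"
      using that by (simp_all add: free_group_def)
    then have "fst ` set (?n w) \<subseteq> free_gen ` A"
      unfolding fst_n by (intro image_mono)
    then have "word_eval ?F (?n w) = reduce_word (?m (?n w))"
      by (rule word_eval_free_gen)
    then show ?thesis unfolding mn reduce_id[OF red] .
  qed
  have "word_eval ?F \<in> hom ?G ?F"
  proof (rule homI)
    fix w assume "w \<in> carrier ?G"
    then show "word_eval ?F w \<in> carrier ?F" unfolding carrG using ev by force
  next
    fix u v assume "u \<in> carrier ?G" "v \<in> carrier ?G"
    then obtain u' v' where u': "u = ?n u'" "u' \<in> carrier ?F" and v': "v = ?n v'" "v' \<in> carrier ?F"
      unfolding carrG by blast
    have "u \<otimes>\<^bsub>?G\<^esub> v = ?n (u' \<otimes>\<^bsub>?F\<^esub> v')"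
      using reduce_n[of "u' @ v'", unfolded map_append]
      by (simp only: free_group_def u'(1) v'(1) monoid.simps partial_object.simps)
    moreover have "u' \<otimes>\<^bsub>?F\<^esub> v' \<in> carrier ?F"
      using u' v' group_free_group[of A] by (meson group.is_monoid monoid.m_closed)
    ultimately show "word_eval ?F (u \<otimes>\<^bsub>?G\<^esub> v) = word_eval ?F u \<otimes>\<^bsub>?F\<^esub> word_eval ?F v"
      unfolding u'(1) v'(1) by (simp only: ev u'(2) v'(2))
  qed
  moreover have "bij_betw (word_eval ?F) (carrier ?G) (carrier ?F)"
    by (rule bij_betw_byWitness[where f' = ?n]) (auto simp only: carrG ev image_iff)
  moreover have "free_gen ` A \<subseteq> carrier ?F"
    by (auto simp: free_group_def reduced_word_def)
  ultimately show ?thesis by (simp add: free_basis_def iso_def)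
qed

end

theory Submission
  imports Defs "HOL-Algebra.Coset" "HOL-Library.Sublist"
begin

text \<open>The edges of \<open>\<Gamma>\<^sub>Y(K)\<close> are those traversed, in the Schreier graph of \<open>K\<close>, by the reduced words
  of elements of \<open>K\<close>.  Since \<open>K\<close> is finitely generated and the trace of \<open>x\<^sup>n y\<close>, for \<open>n\<close> large,
  contains those of \<open>x\<close> and \<open>y\<close>, some \<open>k \<in> K\<close> traverses all edges.  Conjugating \<open>H\<close> by \<open>g \<in> K\<close> does
  not change \<open>K\<close>, so it suffices to find \<open>1 \<noteq> h \<in> H\<close> and \<open>g \<in> K\<close> such that \<open>g h\<^sup>i g\<inverse>\<close> traverses
  whatever \<open>k\<close> does.  Write \<open>k\<close> in reduced form \<open>t c t\<inverse>\<close> with \<open>c\<close> cyclically reduced.  If some power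
  of \<open>h\<close> begins with \<open>t c\<inverse>\<close>, then that power will do.  Otherwise only a bounded part of
  \<open>k\<^sup>n\<close> cancels in the product \<open>k\<^sup>n h\<^sup>i\<close>, so for large \<open>n\<close> and much larger \<open>i\<close> the reduced form of
  \<open>k\<^sup>n h\<^sup>i k\<^sup>-\<^sup>n\<close> begins with \<open>t c\<close>.\<close>

section \<open>Reduced words\<close>

definition word_inv :: "'a letter list \<Rightarrow> 'a letter list" where
  "word_inv w = map letter_inv (rev w)"

lemma word_inv_simps [simp]:
  "word_inv [] = []"
  "word_inv (x # w) = word_inv w @ [letter_inv x]"
  "word_inv (u @ v) = word_inv v @ word_inv u"
  "word_inv (word_inv w) = w"
  "length (word_inv w) = length w"
  by (simp_all add: word_inv_def rev_map o_def)

lemma fst_set_word_inv [simp]: "fst ` set (word_inv w) = fst ` set w"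
  by (simp add: word_inv_def image_image)

lemma reduced_word_simps [simp]:
  "reduced_word []"
  "reduced_word [x]"
  "reduced_word (x # y # w) \<longleftrightarrow> y \<noteq> letter_inv x \<and> reduced_word (y # w)"
  by (simp_all add: reduced_word_def)

lemma reduced_word_append_iff:
  "reduced_word (u @ v) \<longleftrightarrow>
     reduced_word u \<and> reduced_word v \<and> (u \<noteq> [] \<longrightarrow> v \<noteq> [] \<longrightarrow> hd v \<noteq> letter_inv (last u))"
  by (auto simp: reduced_word_def successively_append_iff)

lemma reduced_word_inv [simp]: "reduced_word (word_inv w) \<longleftrightarrow> reduced_word w"
proof -
  have "reduced_word (word_inv w)" if "reduced_word w" for w :: "'a letter list"
    using that
  proof (induction w)
    case (Cons x w)
    then show ?case
      by (cases w) (auto simp: reduced_word_append_iff)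
  qed simp
  from this[of w] this[of "word_inv w"] show ?thesis by auto
qed

lemma reduce_word_cancel_pair: "reduce_word (u @ x # letter_inv x # v) = reduce_word (u @ v)"
proof -
  have "reduce_word (x # letter_inv x # v) = reduce_word v"
    using push_cancel[OF reduced_reduce[of v], of x] by (simp add: reduce_word_def)
  then show ?thesis
    by (metis reduce_append_right)
qed

text \<open>Induction from the right end of \<open>u\<close>: as long as its last letter is inverse
  to the first letter of \<open>v\<close>, the pair goes into \<open>p\<close>. At the first pair
  that does not cancel, the concatenation is already reduced.\<close>

lemma reduce_word_product:
  assumes "reduced_word u" "reduced_word v"
  shows "\<exists>u' p v'. u = u' @ word_inv p \<and> v = p @ v' \<and> reduce_word (u @ v) = u' @ v'"
  using assms
proof (induction u arbitrary: v rule: rev_induct)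
  case Nil
  then show ?case by (intro exI[of _ "[]"] exI[of _ v]) (simp add: reduce_id)
next
  case (snoc x u)
  show ?case
  proof (cases "v \<noteq> [] \<and> hd v = letter_inv x")
    case True
    then obtain w where v: "v = letter_inv x # w" by (cases v) auto
    then have "reduced_word u" "reduced_word w"
      using snoc.prems by (auto simp: reduced_word_append_iff) (auto simp: reduced_word_def successively_Cons)
    from snoc.IH[OF this] obtain u' p v'
      where *: "u = u' @ word_inv p" "w = p @ v'" "reduce_word (u @ w) = u' @ v'" by blast
    then show ?thesis
      using reduce_word_cancel_pair[of u x w] v
      by (intro exI[of _ u'] exI[of _ "letter_inv x # p"] exI[of _ v']) simp
  next
    case False
    then have "reduced_word ((u @ [x]) @ v)"
      using snoc.prems by (subst reduced_word_append_iff) auto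
    then show ?thesis
      by (intro exI[of _ "u @ [x]"] exI[of _ "[]"] exI[of _ v]) (simp add: reduce_id)
  qed
qed

text \<open>Cancellation eats \<open>u\<close> from its right end and removes at most
  \<open>length v\<close> letters, so a prefix followed by at least that many letters
  survives.\<close>

lemma prefix_reduce_word_append:
  assumes "reduced_word u" "reduced_word v" "prefix q u" "length q + length v \<le> length u"
  shows "prefix q (reduce_word (u @ v))"
proof -
  obtain u' p v' where *: "u = u' @ word_inv p" "v = p @ v'" "reduce_word (u @ v) = u' @ v'"
    using reduce_word_product[OF assms(1,2)] by blast
  have "prefix u' u" "length q \<le> length u'" using * assms(4) by auto
  then have "prefix q u'" using assms(3) by (metis prefix_length_prefix)
  then show ?thesis using * by simp
qed

lemma length_reduce_word_append:
  assumes "reduced_word u" "reduced_word v"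
  shows "length v \<le> length u + length (reduce_word (u @ v))"
  using reduce_word_product[OF assms] by fastforce

text \<open>\<open>reduced_word (c @ c)\<close> says that \<open>c\<close> is cyclically reduced. If
  the first and last letters of \<open>w\<close> are mutually inverse, both are stripped and the
  first one is added to \<open>t\<close>; otherwise \<open>w\<close> itself serves as
  \<open>c\<close>.\<close>

lemma cyclic_reduction:
  assumes "reduced_word w" "w \<noteq> []"
  shows "\<exists>t c. w = t @ c @ word_inv t \<and> c \<noteq> [] \<and> reduced_word (c @ c)"
  using assms
proof (induction w rule: length_induct)
  case (1 w)
  show ?case
  proof (cases "hd w = letter_inv (last w)")
    case False
    then show ?thesis
      using "1.prems" by (intro exI[of _ "[]"] exI[of _ w]) (simp add: reduced_word_append_iff)
  next
    case True
    then obtain x v where w: "w = x # v @ [letter_inv x]"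
      using "1.prems"(2) by (cases w; cases "tl w" rule: rev_cases) auto
    \<comment> \<open>An empty \<open>v\<close> would leave only a letter followed by its inverse,
      which is not reduced.\<close>
    then have "v \<noteq> []" "reduced_word v"
      using "1.prems"(1) by (auto simp: reduced_word_def successively_Cons successively_append_iff)
    then obtain t c where "v = t @ c @ word_inv t" "c \<noteq> []" "reduced_word (c @ c)"
      using "1.IH"[rule_format, of v] w by auto
    then show ?thesis
      using w by (intro exI[of _ "x # t"] exI[of _ c]) simp
  qed
qed

text \<open>Only the junctions of \<open>t\<close> with \<open>c\<close>, of \<open>c\<close> with
  \<open>c\<close> and of \<open>c\<close> with the inverse of \<open>t\<close> occur, and each of
  them is reduced by assumption.\<close>

lemma reduced_word_power:
  assumes "reduced_word (t @ c @ word_inv t)" "c \<noteq> []" "reduced_word (c @ c)"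
  shows "reduced_word (t @ concat (replicate (Suc n) c) @ word_inv t)"
proof -
  \<comment> \<open>The first letter is carried through the induction because the next junction on
    the left depends on it alone.\<close>
  have *: "reduced_word (concat (replicate (Suc n) c) @ word_inv t) \<and>
      hd (concat (replicate (Suc n) c) @ word_inv t) = hd c" for n
  proof (induction n)
    case 0
    then show ?case using assms by (auto simp: reduced_word_append_iff)
  next
    case (Suc n)
    then have "reduced_word (c @ (concat (replicate (Suc n) c) @ word_inv t))"
      using assms by (subst reduced_word_append_iff) (auto simp: reduced_word_append_iff[of c c])
    then show ?case using assms(2) by simp
  qed
  show ?thesis
    using *[of n] assms by (subst reduced_word_append_iff) (auto simp: reduced_word_append_iff[of t])
qed

section \<open>Evaluation of words and their traces in Schreier graphs\<close>

definition letter_eval :: "('g, 'm) monoid_scheme \<Rightarrow> 'g letter \<Rightarrow> 'g" where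
  "letter_eval F x = (if snd x then fst x else inv\<^bsub>F\<^esub> (fst x))"

lemma word_eval_simps [simp]:
  "word_eval F [] = \<one>\<^bsub>F\<^esub>"
  "word_eval F (x # w) = letter_eval F x \<otimes>\<^bsub>F\<^esub> word_eval F w"
  by (simp_all add: word_eval_def letter_eval_def split_def)

text \<open>An edge of the Schreier graph of right cosets is encoded as a pair
  \<open>(C, l)\<close>, running from \<open>C\<close> to \<open>C #> l\<close>; the path reads the
  word from the coset \<open>C\<close>.\<close>

fun coset_path :: "('g, 'm) monoid_scheme \<Rightarrow> 'g set \<Rightarrow> 'g letter list \<Rightarrow> ('g set \<times> 'g) list" where
  "coset_path F C [] = []"
| "coset_path F C (x # w) =
     (C, letter_eval F x) # coset_path F (C #>\<^bsub>F\<^esub> letter_eval F x) w"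

definition coset_edge_opp :: "('g, 'm) monoid_scheme \<Rightarrow> 'g set \<times> 'g \<Rightarrow> 'g set \<times> 'g" where
  "coset_edge_opp F e = (fst e #>\<^bsub>F\<^esub> snd e, inv\<^bsub>F\<^esub> (snd e))"

text \<open>Including opposites makes the trace blind to the direction in which an edge is crossed,
  so a word and its inverse, read from the two ends of one path, have equal traces.\<close>

definition coset_trace :: "('g, 'm) monoid_scheme \<Rightarrow> 'g set \<Rightarrow> 'g letter list \<Rightarrow> ('g set \<times> 'g) set" where
  "coset_trace F C w = set (coset_path F C w) \<union> coset_edge_opp F ` set (coset_path F C w)"

lemma coset_trace_simps [simp]:
  "coset_trace F C [] = {}"
  "coset_trace F C (x # w) =
     {(C, letter_eval F x), coset_edge_opp F (C, letter_eval F x)} \<union>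
     coset_trace F (C #>\<^bsub>F\<^esub> letter_eval F x) w"
  by (auto simp: coset_trace_def)

context group
begin

lemma letter_eval_closed [simp]: "fst x \<in> carrier G \<Longrightarrow> letter_eval G x \<in> carrier G"
  by (simp add: letter_eval_def)

lemma letter_eval_inv [simp]: "fst x \<in> carrier G \<Longrightarrow> letter_eval G (letter_inv x) = inv (letter_eval G x)"
  by (simp add: letter_eval_def letter_inv_def)

lemma word_eval_closed [simp]: "fst ` set w \<subseteq> carrier G \<Longrightarrow> word_eval G w \<in> carrier G"
  by (induction w) auto

lemma word_eval_append:
  "fst ` set u \<subseteq> carrier G \<Longrightarrow> fst ` set v \<subseteq> carrier G \<Longrightarrow>
     word_eval G (u @ v) = word_eval G u \<otimes> word_eval G v"
  by (induction u) (auto simp: m_assoc)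

lemma word_eval_word_inv:
  "fst ` set w \<subseteq> carrier G \<Longrightarrow> word_eval G (word_inv w) = inv (word_eval G w)"
  by (induction w) (auto simp: word_eval_append inv_mult_group)

lemma word_eval_push:
  "fst x \<in> carrier G \<Longrightarrow> fst ` set w \<subseteq> carrier G \<Longrightarrow>
     word_eval G (push_letter x w) = letter_eval G x \<otimes> word_eval G w"
  by (cases w) (auto simp: m_assoc[symmetric])

lemma word_eval_reduce:
  "fst ` set w \<subseteq> carrier G \<Longrightarrow> word_eval G (reduce_word w) = word_eval G w"
proof (induction w)
  case (Cons x w)
  have "fst ` set (reduce_word w) \<subseteq> carrier G"
    using set_reduce[of w] Cons.prems by auto
  then show ?case
    using Cons word_eval_push[of x "reduce_word w"] by (simp add: reduce_word_def)
qed (simp add: reduce_word_def)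

lemma word_eval_replicate:
  "fst ` set c \<subseteq> carrier G \<Longrightarrow> word_eval G (concat (replicate n c)) = word_eval G c [^] n"
proof (induction n)
  case (Suc n)
  have "fst ` set (concat (replicate n c)) \<subseteq> carrier G"
    using Suc.prems by (auto simp: image_subset_iff)
  then have "word_eval G (concat (replicate (Suc n) c)) = word_eval G c \<otimes> word_eval G c [^] n"
    using Suc by (simp add: word_eval_append)
  then show ?case using Suc.prems by (simp only: nat_pow_Suc2 word_eval_closed)
qed simp

lemma coset_edge_opp_opp:
  "C \<subseteq> carrier G \<Longrightarrow> l \<in> carrier G \<Longrightarrow> coset_edge_opp G (coset_edge_opp G (C, l)) = (C, l)"
  by (simp add: coset_edge_opp_def coset_mult_assoc)

lemma coset_path_append:
  assumes "C \<subseteq> carrier G" "fst ` set u \<subseteq> carrier G" "fst ` set v \<subseteq> carrier G"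
  shows "coset_path G C (u @ v) = coset_path G C u @ coset_path G (C #> word_eval G u) v"
  using assms by (induction u arbitrary: C) (auto simp: coset_mult_assoc r_coset_subset_G)

lemma coset_trace_append:
  assumes "C \<subseteq> carrier G" "fst ` set u \<subseteq> carrier G" "fst ` set v \<subseteq> carrier G"
  shows "coset_trace G C (u @ v) = coset_trace G C u \<union> coset_trace G (C #> word_eval G u) v"
  using assms by (auto simp: coset_trace_def coset_path_append)

lemma coset_path_split:
  assumes "C \<subseteq> carrier G" "fst ` set w \<subseteq> carrier G" "e \<in> set (coset_path G C w)"
  shows "\<exists>u y v. w = u @ y # v \<and> e = (C #> word_eval G u, letter_eval G y)"
  using assms
proof (induction w arbitrary: C)
  case (Cons x w)
  show ?case
  proof (cases "e = (C, letter_eval G x)")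
    case True
    then show ?thesis using Cons.prems by (intro exI[of _ "[]"]) auto
  next
    case False
    then obtain u y v where "w = u @ y # v" "e = (C #> letter_eval G x #> word_eval G u, letter_eval G y)"
      using Cons.IH[of "C #> letter_eval G x"] Cons.prems by (auto simp: r_coset_subset_G)
    then show ?thesis using Cons.prems
      by (intro exI[of _ "x # u"] exI[of _ y] exI[of _ v]) (simp add: coset_mult_assoc image_Un)
  qed
qed simp

lemma coset_path_mem:
  assumes "C \<subseteq> carrier G" "fst ` set w \<subseteq> carrier G" "e \<in> set (coset_path G C w)"
  shows "fst e \<subseteq> carrier G" "snd e \<in> letter_eval G ` set w"
proof -
  obtain u y v where *: "w = u @ y # v" "e = (C #> word_eval G u, letter_eval G y)"
    using coset_path_split[OF assms] by blast
  then have "fst ` set u \<subseteq> carrier G" using assms(2) by (simp add: image_Un)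
  then show "fst e \<subseteq> carrier G" "snd e \<in> letter_eval G ` set w"
    using * assms(1) by (simp_all add: r_coset_subset_G)
qed

lemma set_coset_path_word_inv:
  assumes "C \<subseteq> carrier G" "fst ` set w \<subseteq> carrier G"
  shows "set (coset_path G (C #> word_eval G w) (word_inv w)) =
    coset_edge_opp G ` set (coset_path G C w)"
  using assms
proof (induction w arbitrary: C)
  case (Cons x w)
  define D where "D = C #> letter_eval G x"
  have x: "letter_eval G x \<in> carrier G" and w: "fst ` set w \<subseteq> carrier G"
    using Cons.prems by auto
  have D: "D \<subseteq> carrier G" "C #> word_eval G (x # w) = D #> word_eval G w"
      "D #> word_eval G w \<subseteq> carrier G"
    using Cons.prems x w by (auto simp: D_def coset_mult_assoc r_coset_subset_G)
  have "D #> word_eval G w #> word_eval G (word_inv w) = D"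
    using D(1) w by (simp add: word_eval_word_inv coset_mult_assoc)
  moreover have "coset_edge_opp G (C, letter_eval G x) = (D, inv (letter_eval G x))"
    by (simp add: coset_edge_opp_def D_def)
  ultimately show ?case
    using Cons.IH[OF D(1) w] D w Cons.prems
    by (auto simp: coset_path_append D_def[symmetric])
qed simp

lemma coset_trace_word_inv:
  assumes "C \<subseteq> carrier G" "fst ` set w \<subseteq> carrier G"
  shows "coset_trace G (C #> word_eval G w) (word_inv w) = coset_trace G C w"
proof -
  have "coset_edge_opp G (coset_edge_opp G e) = e" if "e \<in> set (coset_path G C w)" for e
    using coset_path_mem[OF assms that] assms(2) coset_edge_opp_opp[of "fst e" "snd e"] by auto
  then show ?thesis
    by (auto simp: coset_trace_def set_coset_path_word_inv assms image_image)
qed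

text \<open>If \<open>x\<close> cancels the first letter of \<open>w\<close>, the two steps lead
  from \<open>C\<close> back to \<open>C\<close>, so the remaining word is read from the same coset
  as before. Hence free reduction can only lose edges.\<close>

lemma coset_trace_push:
  assumes "C \<subseteq> carrier G" "fst x \<in> carrier G" "fst ` set w \<subseteq> carrier G"
  shows "coset_trace G C (push_letter x w) \<subseteq> coset_trace G C (x # w)"
proof (cases w)
  case (Cons y v)
  then show ?thesis using assms by (auto simp: coset_mult_assoc)
qed simp

lemma coset_trace_reduce:
  "C \<subseteq> carrier G \<Longrightarrow> fst ` set w \<subseteq> carrier G \<Longrightarrow>
     coset_trace G C (reduce_word w) \<subseteq> coset_trace G C w"
proof (induction w arbitrary: C)
  case (Cons x w)
  have "fst ` set (reduce_word w) \<subseteq> carrier G"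
    using set_reduce[of w] Cons.prems by auto
  then have "coset_trace G C (push_letter x (reduce_word w)) \<subseteq> coset_trace G C (x # reduce_word w)"
    using Cons.prems by (intro coset_trace_push) auto
  moreover have "coset_trace G (C #> letter_eval G x) (reduce_word w)
      \<subseteq> coset_trace G (C #> letter_eval G x) w"
    using Cons.prems by (intro Cons.IH) (auto simp: r_coset_subset_G)
  ultimately show ?case by (auto simp: reduce_word_def)
qed (simp add: reduce_word_def)

end

section \<open>Paths and morphisms\<close>

lemma is_path_verts: "serre_graph \<Gamma> \<Longrightarrow> is_path \<Gamma> u p v \<Longrightarrow> u \<in> verts \<Gamma> \<and> v \<in> verts \<Gamma> \<and> set p \<subseteq> edges \<Gamma>"
  by (induction p arbitrary: u) (auto simp: serre_graph_def)

lemma is_path_append_iff: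
  "serre_graph \<Gamma> \<Longrightarrow> is_path \<Gamma> u (p @ q) v \<longleftrightarrow> (\<exists>m. is_path \<Gamma> u p m \<and> is_path \<Gamma> m q v)"
  by (induction p arbitrary: u) (auto dest: is_path_verts)

lemma foldedD:
  "folded \<Gamma> \<Longrightarrow> e \<in> edges \<Gamma> \<Longrightarrow> f \<in> edges \<Gamma> \<Longrightarrow> origin \<Gamma> e = origin \<Gamma> f \<Longrightarrow>
     label \<Gamma> e = label \<Gamma> f \<Longrightarrow> e = f"
  unfolding folded_def by blast

lemma folded_path_unique:
  assumes "folded \<Gamma>" "is_path \<Gamma> u p v" "is_path \<Gamma> u q w" "map (label \<Gamma>) p = map (label \<Gamma>) q"
  shows "v = w"
  using assms(2-)
proof (induction p arbitrary: u q)
  case (Cons e p)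
  then obtain f q' where q: "q = f # q'" by (cases q) auto
  have "e = f" using Cons.prems by (intro foldedD[OF assms(1)]) (auto simp: q)
  then show ?case using Cons.prems by (auto simp: q intro: Cons.IH)
qed simp

lemma pl_morphism_path:
  "pl_morphism \<Gamma> \<Delta> \<phi> \<psi> \<Longrightarrow> serre_graph \<Gamma> \<Longrightarrow> is_path \<Gamma> u p v \<Longrightarrow> is_path \<Delta> (\<phi> u) (map \<psi> p) (\<phi> v)"
  by (induction p arbitrary: u) (auto simp: pl_morphism_def serre_graph_def)

lemma pl_morphism_path_label:
  "pl_morphism \<Gamma> \<Delta> \<phi> \<psi> \<Longrightarrow> set p \<subseteq> edges \<Gamma> \<Longrightarrow> path_label F \<Delta> (map \<psi> p) = path_label F \<Gamma> p"
  by (induction p) (auto simp: pl_morphism_def path_label_def)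

section \<open>Traces of elements of a subgroup\<close>

locale based_group = group +
  fixes Y
  assumes basis: "free_basis G Y"
begin

lemma basis_closed: "Y \<subseteq> carrier G"
  using basis by (simp add: free_basis_def)

lemma carrier_free_group_iff:
  "w \<in> carrier (free_group Y) \<longleftrightarrow> fst ` set w \<subseteq> Y \<and> reduced_word w"
  by (simp add: free_group_def)

lemma bij_betw_word_eval: "bij_betw (word_eval G) (carrier (free_group Y)) (carrier G)"
  using basis by (simp add: free_basis_def iso_def)

section \<open>Reduced words of group elements over a free basis\<close>

definition normal_word :: "'a \<Rightarrow> 'a letter list" where
  "normal_word x = inv_into (carrier (free_group Y)) (word_eval G) x"

lemma normal_word:
  assumes "x \<in> carrier G"
  shows "fst ` set (normal_word x) \<subseteq> Y" "reduced_word (normal_word x)"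
    "fst ` set (normal_word x) \<subseteq> carrier G" "word_eval G (normal_word x) = x"
proof -
  have "x \<in> word_eval G ` carrier (free_group Y)"
    using assms bij_betw_word_eval by (simp add: bij_betw_def)
  from inv_into_into[OF this] f_inv_into_f[OF this] basis_closed
  show "fst ` set (normal_word x) \<subseteq> Y" "reduced_word (normal_word x)"
    "fst ` set (normal_word x) \<subseteq> carrier G" "word_eval G (normal_word x) = x"
    unfolding normal_word_def carrier_free_group_iff by auto
qed

lemma normal_word_eqI:
  assumes "fst ` set w \<subseteq> Y" "reduced_word w" "word_eval G w = x"
  shows "normal_word x = w"
  using assms bij_betw_word_eval
  by (auto simp: normal_word_def carrier_free_group_iff bij_betw_def)

lemma normal_word_mult:
  assumes "x \<in> carrier G" "y \<in> carrier G"
  shows "normal_word (x \<otimes> y) = reduce_word (normal_word x @ normal_word y)"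
proof (rule normal_word_eqI)
  let ?w = "normal_word x @ normal_word y"
  show "fst ` set (reduce_word ?w) \<subseteq> Y"
    using set_reduce[of ?w] normal_word(1)[OF assms(1)] normal_word(1)[OF assms(2)]
    by (auto simp: image_subset_iff)
  show "word_eval G (reduce_word ?w) = x \<otimes> y"
    using normal_word(3,4)[OF assms(1)] normal_word(3,4)[OF assms(2)]
    by (subst word_eval_reduce) (simp_all add: word_eval_append image_Un)
qed (rule reduced_reduce)

lemma prefix_normal_word_mult:
  assumes "x \<in> carrier G" "y \<in> carrier G" "prefix q (normal_word x)"
    "length q + length (normal_word y) \<le> length (normal_word x)"
  shows "prefix q (normal_word (x \<otimes> y))"
  using prefix_reduce_word_append[OF normal_word(2)[OF assms(1)] normal_word(2)[OF assms(2)] assms(3,4)]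
  by (simp add: normal_word_mult assms)

lemma normal_word_one: "normal_word \<one> = []"
  by (rule normal_word_eqI) simp_all

lemma normal_word_inv:
  "x \<in> carrier G \<Longrightarrow> normal_word (inv x) = word_inv (normal_word x)"
  using normal_word[of x] by (intro normal_word_eqI) (simp_all add: word_eval_word_inv)

lemma normal_word_eq_Nil_iff: "x \<in> carrier G \<Longrightarrow> normal_word x = [] \<longleftrightarrow> x = \<one>"
  using normal_word(4)[of x] normal_word_one by auto

section \<open>Edges of the Schreier graph traversed by elements of a subgroup\<close>

abbreviation trace :: "'a set \<Rightarrow> 'a \<Rightarrow> ('a set \<times> 'a) set" where
  "trace K x \<equiv> coset_trace G K (normal_word x)"

lemma trace_prefix_subset:
  assumes "subgroup K G" "x \<in> carrier G" "prefix q (normal_word x)"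
  shows "coset_trace G K q \<subseteq> trace K x"
proof -
  obtain v where v: "normal_word x = q @ v"
    using assms(3) by (auto simp: prefix_def)
  have "fst ` set (q @ v) \<subseteq> carrier G" using normal_word(3)[OF assms(2)] unfolding v .
  then show ?thesis
    using coset_trace_append[OF subgroup.subset[OF assms(1)], of q v] by (auto simp: v image_Un)
qed

lemma trace_inv:
  assumes "subgroup K G" "x \<in> K"
  shows "trace K (inv x) = trace K x"
proof -
  have x: "x \<in> carrier G" using assms by (rule subgroup.mem_carrier)
  have "K #> x = K" using assms x by (intro coset_join2)
  then show ?thesis
    using coset_trace_word_inv[OF subgroup.subset[OF assms(1)] normal_word(3)[OF x]]
    by (simp add: normal_word_inv x normal_word(4))
qed

text \<open>As \<open>x\<close> lies in \<open>K\<close>, its path returns to the coset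
  \<open>K\<close>, so the path of \<open>y\<close> starts there as it should; reducing the
  concatenated word only drops edges.\<close>

lemma trace_mult:
  assumes "subgroup K G" "x \<in> K" "y \<in> K"
  shows "trace K (x \<otimes> y) \<subseteq> trace K x \<union> trace K y"
proof -
  have x: "x \<in> carrier G" and y: "y \<in> carrier G"
    using assms by (simp_all add: subgroup.mem_carrier[OF assms(1)])
  have K: "K \<subseteq> carrier G" using assms(1) by (rule subgroup.subset)
  have "K #> x = K" using assms x by (intro coset_join2)
  then show ?thesis
    using coset_trace_reduce[OF K, of "normal_word x @ normal_word y"]
      coset_trace_append[OF K normal_word(3)[OF x] normal_word(3)[OF y]]
      normal_word(3)[OF x] normal_word(3)[OF y]
    by (simp add: normal_word_mult x y normal_word(4) image_Un)
qed

lemma trace_pow: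
  assumes "subgroup K G" "x \<in> K"
  shows "x [^] (n::nat) \<in> K \<and> trace K (x [^] n) \<subseteq> trace K x"
proof (induction n)
  case 0
  then show ?case using assms(1) by (simp add: normal_word_one subgroup.one_closed)
next
  case (Suc n)
  then show ?case
    using trace_mult[OF assms(1), of "x [^] n" x] assms(2) subgroup.m_closed[OF assms(1)] by fastforce
qed

text \<open>If the normal word of \<open>x\<close> is \<open>t c t\<inverse>\<close> with \<open>c\<close> cyclically reduced, then that of \<open>x\<^sup>n\<close> is
  \<open>t c\<^sup>n t\<inverse>\<close>, and \<open>t c\<close> already traverses all edges of the closed path \<open>t c t\<inverse>\<close>.\<close>

lemma stable_prefix:
  assumes "x \<in> carrier G" "x \<noteq> \<one>"
  obtains q where "\<And>n::nat. n > 0 \<Longrightarrow> prefix q (normal_word (x [^] n))"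
    and "\<And>n::nat. n \<le> length (normal_word (x [^] n))"
    and "\<And>K. subgroup K G \<Longrightarrow> x \<in> K \<Longrightarrow> trace K x \<subseteq> coset_trace G K q"
proof -
  have "normal_word x \<noteq> []" using assms by (simp add: normal_word_eq_Nil_iff)
  then obtain t c where w: "normal_word x = t @ c @ word_inv t" and c: "c \<noteq> []" "reduced_word (c @ c)"
    using cyclic_reduction[OF normal_word(2)[OF assms(1)]] by blast
  have "fst ` set (t @ c @ word_inv t) \<subseteq> Y" "word_eval G (t @ c @ word_inv t) = x"
    "reduced_word (t @ c @ word_inv t)"
    using normal_word[OF assms(1)] unfolding w by blast+
  then have Y: "fst ` set t \<subseteq> Y" "fst ` set c \<subseteq> Y" and red: "reduced_word (t @ c @ word_inv t)"
    and x: "word_eval G (t @ c @ word_inv t) = x" by (auto simp: image_Un)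
  then have t: "fst ` set t \<subseteq> carrier G" and cc: "fst ` set c \<subseteq> carrier G"
    using basis_closed by auto
  define a b where "a = word_eval G t" and "b = word_eval G c"
  have ab: "a \<in> carrier G" "b \<in> carrier G" using t cc by (simp_all add: a_def b_def)
  have xab: "x = a \<otimes> b \<otimes> inv a"
    using x t cc by (simp add: word_eval_append word_eval_word_inv a_def b_def image_Un m_assoc)
  have pow: "x [^] n = a \<otimes> b [^] n \<otimes> inv a" for n :: nat
  proof (induction n)
    case (Suc n)
    have "x [^] Suc n = (a \<otimes> b [^] n \<otimes> inv a) \<otimes> (a \<otimes> b \<otimes> inv a)"
      using Suc xab by simp
    also have "\<dots> = a \<otimes> b [^] n \<otimes> (inv a \<otimes> a) \<otimes> b \<otimes> inv a"
      using ab by (simp only: m_assoc m_closed inv_closed nat_pow_closed)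
    also have "\<dots> = a \<otimes> b [^] Suc n \<otimes> inv a"
      using ab by (simp add: m_assoc)
    finally show ?case .
  qed (use ab in simp)
  have nw: "normal_word (x [^] Suc n) = t @ concat (replicate (Suc n) c) @ word_inv t" for n
  proof (rule normal_word_eqI)
    have *: "fst ` set (concat (replicate (Suc n) c)) \<subseteq> Y"
      using Y by (auto simp: image_subset_iff)
    then show "fst ` set (t @ concat (replicate (Suc n) c) @ word_inv t) \<subseteq> Y"
      using Y by (simp add: image_Un del: set_concat set_replicate replicate_Suc)
    have "fst ` set (concat (replicate (Suc n) c)) \<subseteq> carrier G" using * basis_closed by blast
    then show "word_eval G (t @ concat (replicate (Suc n) c) @ word_inv t) = x [^] Suc n"
      using t cc ab unfolding pow
      by (simp add: word_eval_append word_eval_word_inv image_Un word_eval_replicate m_assoc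
            a_def[symmetric] b_def[symmetric] del: replicate_Suc set_concat nat_pow_Suc)
  qed (rule reduced_word_power[OF red c])
  show ?thesis
  proof (rule that[of "t @ c"])
    fix n :: nat
    assume "n > 0"
    then show "prefix (t @ c) (normal_word (x [^] n))"
      by (cases n) (simp_all only: nw, simp_all)
  next
    fix n :: nat
    show "n \<le> length (normal_word (x [^] n))"
    proof (cases n)
      case (Suc m)
      have "n \<le> n * length c" using c(1) by (cases c) auto
      also have "n * length c = length (concat (replicate n c))"
        by (induction n) auto
      finally show ?thesis unfolding Suc nw by simp
    qed simp
  next
    fix K assume K: "subgroup K G" "x \<in> K"
    have sub: "K \<subseteq> carrier G" using K(1) by (rule subgroup.subset)
    \<comment> \<open>Since \<open>a \<otimes> b\<close> equals \<open>x \<otimes> a\<close> and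
      \<open>x\<close> fixes the coset \<open>K\<close>, the closing segment starts where
      \<open>t\<close> ended and merely retraces \<open>t\<close> backwards.\<close>
    have "K #> (a \<otimes> b) = K #> a"
    proof -
      have "K #> (a \<otimes> b) = K #> x #> a"
        using ab sub assms(1) by (simp add: coset_mult_assoc xab m_assoc)
      then show ?thesis using K assms(1) by (simp add: coset_join2)
    qed
    then have "coset_trace G (K #> word_eval G (t @ c)) (word_inv t) = coset_trace G K t"
      using coset_trace_word_inv[OF sub t] t cc by (simp add: word_eval_append a_def b_def)
    then show "trace K x \<subseteq> coset_trace G K (t @ c)"
      using t cc sub coset_trace_append[OF sub, of "t @ c" "word_inv t"]
      by (auto simp: w image_Un coset_trace_append)
  qed
qed

section \<open>Elements of maximal trace\<close>

lemma trace_directed: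
  assumes K: "subgroup K G" and x: "x \<in> K" and y: "y \<in> K"
  shows "\<exists>z\<in>K. trace K x \<union> trace K y \<subseteq> trace K z"
proof (cases "x = \<one>")
  case True
  then show ?thesis using y by (intro bexI[of _ y]) (simp add: normal_word_one)
next
  case False
  have G: "x \<in> carrier G" "y \<in> carrier G" using x y by (simp_all add: subgroup.mem_carrier[OF K])
  obtain q where q: "\<And>n::nat. n > 0 \<Longrightarrow> prefix q (normal_word (x [^] n))"
    "\<And>n::nat. n \<le> length (normal_word (x [^] n))" "trace K x \<subseteq> coset_trace G K q"
    using stable_prefix[OF G(1) False] K x by metis
  \<comment> \<open>The word of the n-th power has length at least \<open>n\<close>, so multiplying
    by \<open>y\<close> cannot reach the prefix \<open>q\<close>; the \<open>Suc\<close> makes the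
    exponent positive, as the prefix property requires.\<close>
  define n where "n = Suc (length q + length (normal_word y))"
  define p where "p = x [^] n"
  have p: "p \<in> K" "trace K p \<subseteq> trace K x" using trace_pow[OF K x] by (auto simp: p_def)
  have pG: "p \<in> carrier G" using G by (simp add: p_def)
  have z: "p \<otimes> y \<in> K" using K p(1) y by (rule subgroup.m_closed)
  have "length q + length (normal_word y) \<le> length (normal_word p)"
    using q(2)[of n] by (simp add: n_def p_def)
  moreover have "prefix q (normal_word p)" unfolding p_def by (rule q(1)) (simp add: n_def)
  ultimately have "prefix q (normal_word (p \<otimes> y))"
    using pG G(2) by (intro prefix_normal_word_mult)
  then have xz: "trace K x \<subseteq> trace K (p \<otimes> y)"
    using q(3) trace_prefix_subset[OF K] pG G(2) by blast
  \<comment> \<open>Edges of \<open>y\<close> missing from the trace of \<open>p \<otimes> y\<close>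
    must lie in that of \<open>p\<close>, hence in that of \<open>x\<close>, which is already
    covered.\<close>
  have "y = inv p \<otimes> (p \<otimes> y)" using pG G(2) by (simp add: m_assoc[symmetric])
  then have "trace K y \<subseteq> trace K (inv p) \<union> trace K (p \<otimes> y)"
    using trace_mult[OF K _ z, of "inv p"] K p(1) by (simp add: subgroup.m_inv_closed)
  then show ?thesis
    using z xz p trace_inv[OF K p(1)] by (intro bexI[of _ "p \<otimes> y"]) auto
qed

text \<open>Directedness gives a common upper bound for the traces of a finite generating set.
  Products and inverses create no new edges, so the bound holds on all of \<open>K\<close>.\<close>

lemma trace_maximum:
  assumes K: "subgroup K G" and fg: "finitely_generated G K"
  shows "\<exists>k\<in>K. \<forall>x\<in>K. trace K x \<subseteq> trace K k"
proof -
  obtain S where S: "finite S" "S \<subseteq> carrier G" "K = generate G S"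
    using fg by (auto simp: finitely_generated_def)
  have "\<exists>k\<in>K. \<forall>s\<in>S'. trace K s \<subseteq> trace K k" if "finite S'" "S' \<subseteq> K" for S'
    using that
  proof (induction S' rule: finite_induct)
    case empty
    then show ?case using subgroup.one_closed[OF K] by auto
  next
    case (insert s S')
    then obtain k where "k \<in> K" "\<forall>s\<in>S'. trace K s \<subseteq> trace K k" by auto
    moreover obtain z where "z \<in> K" "trace K k \<union> trace K s \<subseteq> trace K z"
      using trace_directed[OF K] \<open>k \<in> K\<close> insert.prems by blast
    ultimately show ?case by (intro bexI[of _ z]) auto
  qed
  moreover have "S \<subseteq> K" using S(3) by (auto intro: generate.incl)
  ultimately obtain k where k: "k \<in> K" "\<forall>s\<in>S. trace K s \<subseteq> trace K k"
    using S(1) by blast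
  have "trace K x \<subseteq> trace K k" if "x \<in> generate G S" for x
    using that
  proof (induction rule: generate.induct)
    case (inv h)
    then show ?case using k(2) trace_inv[OF K, of h] \<open>S \<subseteq> K\<close> by blast
  next
    case (eng h1 h2)
    then show ?case using trace_mult[OF K, of h1 h2] S(3) by blast
  qed (use k in \<open>auto simp: normal_word_one\<close>)
  then show ?thesis using k(1) S(3) by blast
qed

lemma trace_conjugate:
  assumes K: "subgroup K G" and k: "k \<in> K" and h: "h \<in> K" "h \<noteq> \<one>"
  shows "\<exists>g\<in>K. \<exists>i::nat. trace K k \<subseteq> trace K (g \<otimes> h [^] i \<otimes> inv g)"
proof (cases "k = \<one>")
  case True
  then show ?thesis using k by (intro bexI[of _ k]) (auto simp: normal_word_one)
next
  case False
  have G: "k \<in> carrier G" "h \<in> carrier G" using k h by (simp_all add: subgroup.mem_carrier[OF K])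
  have k': "inv k \<in> K" "inv k \<in> carrier G" "inv k \<noteq> \<one>"
    using K k G False by (auto simp: subgroup.m_inv_closed)
  obtain q where q: "\<And>n::nat. n > 0 \<Longrightarrow> prefix q (normal_word (k [^] n))"
    "\<And>n::nat. n \<le> length (normal_word (k [^] n))" "trace K k \<subseteq> coset_trace G K q"
    using stable_prefix[OF G(1) False] K k by metis
  \<comment> \<open>For \<open>inv k\<close> the stable prefix \<open>r\<close> is the analogue of
    \<open>q\<close>; as \<open>k\<close> and \<open>inv k\<close> have equal traces, starting with
    \<open>r\<close> is as good as starting with \<open>q\<close>.\<close>
  obtain r where r: "\<And>n::nat. n > 0 \<Longrightarrow> prefix r (normal_word (inv k [^] n))"
    "trace K (inv k) \<subseteq> coset_trace G K r"
    using stable_prefix[OF k'(2,3)] K k' by metis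
  have len_h: "n \<le> length (normal_word (h [^] n))" for n :: nat
    using stable_prefix[OF G(2) h(2)] by metis
  show ?thesis
  proof (cases "\<exists>i::nat. prefix r (normal_word (h [^] i))")
    case True
    then obtain i :: nat where "prefix r (normal_word (h [^] i))" ..
    then have "trace K k \<subseteq> trace K (h [^] i)"
      using trace_prefix_subset[OF K, of "h [^] i" r] r(2) trace_inv[OF K k] G(2) by auto
    then show ?thesis
      using K G(2) by (intro bexI[of _ \<one>] exI[of _ i]) (simp_all add: subgroup.one_closed)
  next
    case no_prefix: False
    \<comment> \<open>Fewer than \<open>length r\<close> letters of \<open>g\<close> will cancel
      against a power of \<open>h\<close>; this exponent makes \<open>g\<close> long enough for
      \<open>q\<close> to remain.\<close>
    define g where "g = k [^] Suc (length q + length r)"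
    have g: "g \<in> K" "g \<in> carrier G"
      using trace_pow[OF K k] G(1) unfolding g_def by blast+
    have inv_g: "inv g = inv k [^] Suc (length q + length r)"
      using G(1) unfolding g_def by (rule nat_pow_inv[symmetric])
    \<comment> \<open>The word of \<open>g \<otimes> h [^] i\<close> has length at least
      \<open>i\<close> minus that of \<open>g\<close>, which leaves room for \<open>q\<close> and
      for everything that \<open>inv g\<close> may cancel.\<close>
    define i where "i = length (normal_word g) + length q + length (normal_word (inv g))"
    define x where "x = h [^] i"
    have x: "x \<in> carrier G" using G(2) by (simp add: x_def)
    obtain u p v where *: "normal_word g = u @ word_inv p" "normal_word x = p @ v"
      "normal_word (g \<otimes> x) = u @ v"
      using reduce_word_product[OF normal_word(2)[OF g(2)] normal_word(2)[OF x]]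
      by (auto simp: normal_word_mult g x)
    \<comment> \<open>The cancelled part \<open>p\<close> begins both the word of \<open>x\<close>
      and that of \<open>inv g\<close>. The latter is a positive power of \<open>inv k\<close> and
      so begins with \<open>r\<close>; a longer \<open>p\<close> would make the power
      \<open>x\<close> of \<open>h\<close> begin with \<open>r\<close> too.\<close>
    have "length p < length r"
    proof (rule ccontr)
      assume "\<not> length p < length r"
      moreover have "prefix r (normal_word (inv g))" unfolding inv_g by (rule r(1)) simp
      moreover have "prefix p (normal_word (inv g))" by (simp add: normal_word_inv g *)
      ultimately have "prefix r p" by (meson linorder_not_less prefix_length_prefix)
      then have "prefix r (normal_word x)" by (simp add: *)
      then show False using no_prefix by (auto simp: x_def)
    qed
    moreover have "Suc (length q + length r) \<le> length (normal_word g)"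
      unfolding g_def by (rule q(2))
    ultimately have "length q \<le> length u" by (simp add: *)
    moreover have "prefix q (normal_word g)" unfolding g_def by (rule q(1)) simp
    moreover have "prefix u (normal_word g)" by (simp add: *)
    ultimately have "prefix q u" by (meson prefix_length_prefix)
    then have "prefix q (normal_word (g \<otimes> x))" by (simp add: *)
    moreover have "length q + length (normal_word (inv g)) \<le> length (normal_word (g \<otimes> x))"
      using length_reduce_word_append[OF normal_word(2)[OF g(2)] normal_word(2)[OF x]] len_h[of i]
      unfolding x_def[symmetric] by (simp add: normal_word_mult g x i_def)
    ultimately have "prefix q (normal_word (g \<otimes> x \<otimes> inv g))"
      using g(2) x by (intro prefix_normal_word_mult[of "g \<otimes> x"]) simp_all
    then have "trace K k \<subseteq> trace K (g \<otimes> x \<otimes> inv g)"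
      using q(3) trace_prefix_subset[OF K] g(2) x by blast
    then show ?thesis using g(1) by (auto simp: x_def)
  qed
qed

section \<open>The core of the Schreier graph\<close>

definition core_edges :: "'a set \<Rightarrow> ('a set \<times> 'a) set" where
  "core_edges K = (\<Union>x\<in>K. set (coset_path G K (normal_word x)))"

text \<open>The coset \<open>K\<close> is inserted among the vertices because for trivial
  \<open>K\<close> there are no core edges to supply the base point.\<close>

definition schreier_core :: "'a set \<Rightarrow> ('a set, 'a set \<times> 'a, 'a) pl_graph" where
  "schreier_core K =
     \<lparr>verts = insert K (fst ` core_edges K), edges = core_edges K, origin = fst,
      opposite = coset_edge_opp G, basepoint = K, label = snd\<rparr>"

lemma schreier_core_simps [simp]:
  "verts (schreier_core K) = insert K (fst ` core_edges K)"
  "edges (schreier_core K) = core_edges K"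
  "origin (schreier_core K) = fst"
  "opposite (schreier_core K) = coset_edge_opp G"
  "basepoint (schreier_core K) = K"
  "label (schreier_core K) = snd"
  by (simp_all add: schreier_core_def)

text \<open>One-letter words are reduced, and evaluation is injective on reduced words over a basis.
  This excludes edges equal to their opposite and backtracking along reduced words.\<close>

lemma letter_eval_neq_inv:
  assumes "fst x \<in> Y" "fst y \<in> Y" "letter_eval G y = inv (letter_eval G x)"
  shows "y = letter_inv x"
proof -
  have "fst x \<in> carrier G" "fst y \<in> carrier G" using assms basis_closed by auto
  then have "word_eval G [y] = word_eval G [letter_inv x]" using assms(3) by simp
  moreover have "[y] \<in> carrier (free_group Y)" "[letter_inv x] \<in> carrier (free_group Y)"
    using assms by (simp_all add: carrier_free_group_iff)
  ultimately show ?thesis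
    using bij_betw_word_eval by (metis bij_betw_def inj_onD list.inject)
qed

lemma core_edge_cases:
  assumes "subgroup K G" "e \<in> core_edges K"
  obtains x u y v where "x \<in> K" "x \<in> carrier G" "normal_word x = u @ y # v"
    "fst ` set (u @ y # v) \<subseteq> carrier G" "fst y \<in> Y" "e = (K #> word_eval G u, letter_eval G y)"
proof -
  obtain x where x: "x \<in> K" "e \<in> set (coset_path G K (normal_word x))"
    using assms(2) by (auto simp: core_edges_def)
  have G: "x \<in> carrier G" using x(1) by (rule subgroup.mem_carrier[OF assms(1)])
  obtain u y v where *: "normal_word x = u @ y # v" "e = (K #> word_eval G u, letter_eval G y)"
    using coset_path_split[OF subgroup.subset[OF assms(1)] normal_word(3)[OF G] x(2)] by blast
  have "fst ` set (u @ y # v) \<subseteq> carrier G" "fst ` set (u @ y # v) \<subseteq> Y"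
    using normal_word(1,3)[OF G] unfolding * by blast+
  then show ?thesis using that[OF x(1) G *(1) _ _ *(2)] by simp
qed

text \<open>For the third claim: if the loop of \<open>x\<close> crosses \<open>e\<close>, then that
  of \<open>inv x\<close>, again an element of \<open>K\<close>, crosses the opposite edge.\<close>

lemma core_edge_in:
  assumes "subgroup K G" "e \<in> core_edges K"
  shows "fst e \<subseteq> carrier G" "snd e \<in> carrier G" "coset_edge_opp G e \<in> core_edges K"
proof -
  note sub = subgroup.subset[OF assms(1)]
  show "fst e \<subseteq> carrier G" "snd e \<in> carrier G"
    by (rule core_edge_cases[OF assms]; use sub in \<open>simp add: image_Un r_coset_subset_G\<close>)+
  obtain x where x: "x \<in> K" "e \<in> set (coset_path G K (normal_word x))"
    using assms(2) by (auto simp: core_edges_def)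
  have G: "x \<in> carrier G" using x(1) by (rule subgroup.mem_carrier[OF assms(1)])
  have "K #> x = K" using G assms(1) x(1) by (rule coset_join2)
  then have "coset_edge_opp G e \<in> set (coset_path G K (normal_word (inv x)))"
    using set_coset_path_word_inv[OF sub normal_word(3)[OF G]] x(2)
    by (simp add: normal_word_inv normal_word(4) G)
  then show "coset_edge_opp G e \<in> core_edges K"
    using x(1) subgroup.m_inv_closed[OF assms(1)] by (auto simp: core_edges_def)
qed

lemma is_path_coset_path:
  assumes "subgroup K G" "C \<in> verts (schreier_core K)" "C \<subseteq> carrier G" "fst ` set w \<subseteq> carrier G"
    "set (coset_path G C w) \<subseteq> core_edges K"
  shows "is_path (schreier_core K) C (coset_path G C w) (C #> word_eval G w)"
  using assms(2-)
proof (induction w arbitrary: C)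
  case (Cons x w)
  have "(C, letter_eval G x) \<in> core_edges K" using Cons.prems(4) by simp
  then have "coset_edge_opp G (C, letter_eval G x) \<in> core_edges K"
    using core_edge_in(3)[OF assms(1)] by blast
  \<comment> \<open>The end of an edge is a vertex of the core because it is the origin of the
    opposite edge.\<close>
  then have "C #> letter_eval G x \<in> verts (schreier_core K)"
    by (force simp: coset_edge_opp_def)
  then have "is_path (schreier_core K) (C #> letter_eval G x) (coset_path G (C #> letter_eval G x) w)
      (C #> letter_eval G x #> word_eval G w)"
    using Cons.prems by (intro Cons.IH) (auto simp: r_coset_subset_G)
  then show ?case
    using Cons.prems by (auto simp: coset_mult_assoc coset_edge_opp_def)
qed auto

lemma pointed_labeled_graph_core:
  assumes K: "subgroup K G"
  shows "pointed_labeled_graph G Y (schreier_core K)"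
proof -
  have "snd e \<in> Y \<union> (\<lambda>b. inv b) ` Y" if e: "e \<in> core_edges K" for e
    by (rule core_edge_cases[OF K e]) (simp add: letter_eval_def)
  moreover have "coset_edge_opp G e \<noteq> e" if e: "e \<in> core_edges K" for e
  proof
    assume "coset_edge_opp G e = e"
    then have i: "inv (snd e) = snd e" by (metis coset_edge_opp_def snd_conv)
    obtain y where "fst y \<in> Y" "snd e = letter_eval G y"
      by (rule core_edge_cases[OF K e]) simp
    then have "y = letter_inv y" using i by (intro letter_eval_neq_inv) auto
    then show False by simp
  qed
  moreover have "coset_edge_opp G (coset_edge_opp G e) = e" if e: "e \<in> core_edges K" for e
    using coset_edge_opp_opp[OF core_edge_in(1,2)[OF K e]] by simp
  ultimately show ?thesis
    unfolding pointed_labeled_graph_def serre_graph_def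
    using core_edge_in(3)[OF K] by (simp add: coset_edge_opp_def[of G])
qed

text \<open>Cutting the loop of \<open>x\<close> at an intermediate vertex joins that vertex to the
  base point in both directions, which yields connectedness.\<close>

lemma core_path:
  assumes K: "subgroup K G" and x: "x \<in> K" and w: "normal_word x = u @ v"
  shows "is_path (schreier_core K) K (coset_path G K u) (K #> word_eval G u)"
    "is_path (schreier_core K) (K #> word_eval G u) (coset_path G (K #> word_eval G u) v) K"
proof -
  have G: "x \<in> carrier G" using x by (rule subgroup.mem_carrier[OF K])
  note sub = subgroup.subset[OF K]
  have uv: "fst ` set u \<subseteq> carrier G" "fst ` set v \<subseteq> carrier G"
    using normal_word(3)[OF G] by (simp_all add: w image_Un)
  have E: "set (coset_path G K u) \<subseteq> core_edges K"
    "set (coset_path G (K #> word_eval G u) v) \<subseteq> core_edges K"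
    using x by (auto simp: core_edges_def w coset_path_append sub uv
                    intro!: bexI[of _ x])
  show p: "is_path (schreier_core K) K (coset_path G K u) (K #> word_eval G u)"
    using K E(1) uv sub by (intro is_path_coset_path) auto
  have "x = word_eval G u \<otimes> word_eval G v"
    using normal_word(4)[OF G] uv by (simp add: w word_eval_append)
  then have "K #> word_eval G u #> word_eval G v = K"
    using uv sub coset_join2[OF G K x] by (simp add: coset_mult_assoc)
  moreover have "serre_graph (schreier_core K)"
    using pointed_labeled_graph_core[OF K] by (simp add: pointed_labeled_graph_def)
  then have "K #> word_eval G u \<in> verts (schreier_core K)"
    using is_path_verts[OF _ p] by blast
  ultimately show "is_path (schreier_core K) (K #> word_eval G u)
      (coset_path G (K #> word_eval G u) v) K"
    using is_path_coset_path[OF K, of "K #> word_eval G u" v] E(2) uv sub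
    by (simp add: r_coset_subset_G)
qed

lemma connected_core:
  assumes K: "subgroup K G"
  shows "connected_graph (schreier_core K)"
proof -
  let ?S = "schreier_core K"
  have *: "\<exists>p q. is_path ?S K p C \<and> is_path ?S C q K" if C: "C \<in> verts ?S" for C
  proof (cases "C = K")
    case True
    then show ?thesis by (intro exI[of _ "[]"]) simp
  next
    case False
    then obtain e where e: "e \<in> core_edges K" "C = fst e" using C by auto
    obtain x u v where "x \<in> K" "normal_word x = u @ v" "C = K #> word_eval G u"
      by (rule core_edge_cases[OF K e(1)]) (use e(2) in simp)
    then show ?thesis using core_path[OF K] by blast
  qed
  have "serre_graph ?S"
    using pointed_labeled_graph_core[OF K] by (simp add: pointed_labeled_graph_def)
  note app = is_path_append_iff[OF this]
  show ?thesis
    unfolding connected_graph_def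
  proof (intro conjI ballI)
    fix a b assume "a \<in> verts ?S" "b \<in> verts ?S"
    then show "\<exists>p. is_path ?S a p b" using *[of a] *[of b] app by blast
  qed simp
qed

lemma reduced_coset_path:
  assumes "C \<subseteq> carrier G" "fst ` set w \<subseteq> Y" "reduced_word w"
  shows "reduced_path (schreier_core K) (coset_path G C w)"
  using assms
proof (induction w arbitrary: C)
  case (Cons x w)
  have x: "letter_eval G x \<in> carrier G" using Cons.prems basis_closed by auto
  have IH: "reduced_path (schreier_core K) (coset_path G (C #> letter_eval G x) w)"
    using Cons.prems x by (intro Cons.IH) (auto simp: r_coset_subset_G reduced_word_def successively_Cons)
  show ?case
  proof (cases w)
    case (Cons y v)
    have "letter_eval G y \<noteq> inv (letter_eval G x)"
      using letter_eval_neq_inv[of x y] Cons.prems Cons by auto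
    then show ?thesis
      using IH Cons by (simp add: reduced_path_def coset_edge_opp_def)
  qed (simp add: reduced_path_def)
qed (simp add: reduced_path_def)

lemma core_graph_core:
  assumes K: "subgroup K G"
  shows "core_graph G Y (schreier_core K)"
proof -
  note sub = subgroup.subset[OF K]
  have path: "is_path (schreier_core K) K (coset_path G K (normal_word x)) K"
    "reduced_path (schreier_core K) (coset_path G K (normal_word x))" if x: "x \<in> K" for x
  proof -
    have G: "x \<in> carrier G" using x by (rule subgroup.mem_carrier[OF K])
    show "is_path (schreier_core K) K (coset_path G K (normal_word x)) K"
      using core_path(1)[OF K x, of "normal_word x" "[]"] coset_join2[OF G K x]
      by (simp add: normal_word(4)[OF G])
    show "reduced_path (schreier_core K) (coset_path G K (normal_word x))"
      using sub normal_word(1,2)[OF G] by (intro reduced_coset_path)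
  qed
  \<comment> \<open>An edge is the pair of its origin and its label, so foldedness is
    immediate.\<close>
  have "folded (schreier_core K)" by (auto simp: folded_def prod_eq_iff)
  moreover have "\<exists>p. is_path (schreier_core K) K p K \<and> reduced_path (schreier_core K) p \<and> e \<in> set p"
    if e: "e \<in> core_edges K" for e
  proof -
    obtain x where "x \<in> K" "e \<in> set (coset_path G K (normal_word x))"
      using e by (auto simp: core_edges_def)
    then show ?thesis using path[of x] by blast
  qed
  ultimately show ?thesis
    using pointed_labeled_graph_core[OF K] connected_core[OF K] by (simp add: core_graph_def)
qed

lemma path_label_coset_path:
  "path_label G (schreier_core K) (coset_path G C w) = word_eval G w"
  by (induction w arbitrary: C) (simp_all add: path_label_def)

lemma stallings_graph_core:
  assumes K: "subgroup K G"
  shows "stallings_graph G Y K (schreier_core K)"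
proof -
  let ?S = "schreier_core K"
  note sub = subgroup.subset[OF K]
  \<comment> \<open>A path from \<open>C\<close> with label \<open>g\<close> ends at
    \<open>C #> g\<close>; for a loop at \<open>K\<close> this forces its label into
    \<open>K\<close>.\<close>
  have *: "path_label G ?S p \<in> carrier G \<and> D = C #> path_label G ?S p"
    if "is_path ?S C p D" "C \<subseteq> carrier G" for C p D
    using that
  proof (induction p arbitrary: C)
    case (Cons e p)
    then have "snd e \<in> carrier G" using core_edge_in(2)[OF K] by simp
    then show ?case
      using Cons.IH[of "C #> snd e"] Cons.prems
      by (auto simp: path_label_def coset_mult_assoc coset_edge_opp_def r_coset_subset_G)
  qed (simp add: path_label_def)
  have "pi1 G ?S = K"
  proof (intro equalityI subsetI)
    fix x assume "x \<in> pi1 G ?S"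
    then obtain p where p: "x = path_label G ?S p" "is_path ?S K p K" by (auto simp: pi1_def)
    from *[OF p(2) sub] p(1) show "x \<in> K" using coset_join1[OF _ _ K] by auto
  next
    fix x assume x: "x \<in> K"
    have G: "x \<in> carrier G" using x by (rule subgroup.mem_carrier[OF K])
    have "is_path ?S K (coset_path G K (normal_word x)) K"
      using core_path(1)[OF K x, of "normal_word x" "[]"] coset_join2[OF G K x]
      by (simp add: normal_word(4)[OF G])
    moreover have "x = path_label G ?S (coset_path G K (normal_word x))"
      by (simp add: path_label_coset_path normal_word(4)[OF G])
    ultimately show "x \<in> pi1 G ?S" unfolding pi1_def by force
  qed
  then show ?thesis using core_graph_core[OF K] by (simp add: stallings_graph_def)
qed

text \<open>The coset of \<open>x\<close> modulo \<open>H\<close> goes to its coset modulo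
  \<open>K\<close>; multiplying by the set \<open>K\<close> from the left expresses this without
  choosing representatives.\<close>

lemma core_morphism:
  assumes H: "subgroup H G" and K: "subgroup K G" and HK: "H \<subseteq> K"
  shows "pl_morphism (schreier_core H) (schreier_core K)
    (\<lambda>C. K <#> C) (\<lambda>e. (K <#> fst e, snd e))"
proof -
  let ?f = "\<lambda>e. (K <#> fst e, snd e)"
  note subH = subgroup.subset[OF H] and subK = subgroup.subset[OF K]
  have shift: "K <#> (C #> x) = (K <#> C) #> x" if "C \<subseteq> carrier G" "x \<in> carrier G" for C x
    using subK that by (simp add: setmult_rcos_assoc)
  have opp: "coset_edge_opp G (?f e) = ?f (coset_edge_opp G e)" if "fst e \<subseteq> carrier G" "snd e \<in> carrier G" for e
    using shift that by (simp add: coset_edge_opp_def)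
  have KH: "K <#> H = K"
  proof
    show "K <#> H \<subseteq> K" using HK K by (auto simp: set_mult_def subgroup.m_closed)
    show "K \<subseteq> K <#> H"
      using subK subgroup.one_closed[OF H] by (force simp: set_mult_def)
  qed
  \<comment> \<open>The map turns the reading of a word from \<open>C\<close> into the reading of
    the same word from its image, so loops of elements of \<open>H\<close> become loops of the same
    elements in \<open>K\<close>.\<close>
  have path: "map ?f (coset_path G C w) = coset_path G (K <#> C) w"
    if "C \<subseteq> carrier G" "fst ` set w \<subseteq> carrier G" for C w
    using that by (induction w arbitrary: C) (auto simp: shift r_coset_subset_G)
  have E: "?f e \<in> core_edges K" if e: "e \<in> core_edges H" for e
  proof -
    obtain x where x: "x \<in> H" "e \<in> set (coset_path G H (normal_word x))"
      using e by (auto simp: core_edges_def)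
    have G: "x \<in> carrier G" using x(1) by (rule subgroup.mem_carrier[OF H])
    have "?f e \<in> set (map ?f (coset_path G H (normal_word x)))"
      unfolding set_map using x(2) by (rule imageI)
    then have "?f e \<in> set (coset_path G K (normal_word x))"
      unfolding path[OF subH normal_word(3)[OF G]] KH .
    then show ?thesis using x(1) HK by (auto simp: core_edges_def)
  qed
  have V: "K <#> C \<in> verts (schreier_core K)" if C: "C \<in> verts (schreier_core H)" for C
  proof (cases "C = H")
    case False
    then obtain e where "e \<in> core_edges H" "C = fst e" using C by auto
    then show ?thesis using E[of e] by (metis fst_conv image_eqI insertCI schreier_core_simps(1))
  qed (simp add: KH)
  then show ?thesis
    unfolding pl_morphism_def using E opp core_edge_in(1,2)[OF H] KH by auto
qed

section \<open>Paths in folded graphs\<close>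

text \<open>Edge labels are group elements, while words consist of signed generators; this recovers
  the sign.\<close>

definition label_letter :: "'a \<Rightarrow> 'a letter" where
  "label_letter l = (if l \<in> Y then (l, True) else (inv l, False))"

lemma label_letter:
  assumes "l \<in> Y \<union> (\<lambda>b. inv b) ` Y"
  shows "fst (label_letter l) \<in> Y" "letter_eval G (label_letter l) = l"
  using assms basis_closed by (auto simp: label_letter_def letter_eval_def)

definition path_word :: "('v, 'e, 'a) pl_graph \<Rightarrow> 'e list \<Rightarrow> 'a letter list" where
  "path_word \<Gamma> p = map (\<lambda>e. label_letter (label \<Gamma> e)) p"

lemma path_word:
  assumes "pointed_labeled_graph G Y \<Gamma>" "set p \<subseteq> edges \<Gamma>"
  shows "fst ` set (path_word \<Gamma> p) \<subseteq> Y" "word_eval G (path_word \<Gamma> p) = path_label G \<Gamma> p"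
    "path_label G \<Gamma> p \<in> carrier G"
proof -
  have l: "label \<Gamma> e \<in> Y \<union> (\<lambda>b. inv b) ` Y" if "e \<in> set p" for e
    using assms that by (simp add: pointed_labeled_graph_def subset_iff)
  then show Y: "fst ` set (path_word \<Gamma> p) \<subseteq> Y"
    by (simp add: path_word_def image_subset_iff label_letter(1) del: Un_iff)
  show *: "word_eval G (path_word \<Gamma> p) = path_label G \<Gamma> p"
    using l by (induction p) (simp_all add: path_word_def path_label_def label_letter(2) del: Un_iff)
  show "path_label G \<Gamma> p \<in> carrier G"
    using word_eval_closed[of "path_word \<Gamma> p"] Y basis_closed * by auto
qed

text \<open>Both edges leave the same vertex with the same label, so foldedness identifies them. A
  cancellation in the label word is thus a backtrack in the graph.\<close>

lemma opposite_eqI: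
  assumes "pointed_labeled_graph G Y \<Gamma>" "folded \<Gamma>" "e \<in> edges \<Gamma>" "f \<in> edges \<Gamma>"
    "origin \<Gamma> f = origin \<Gamma> (opposite \<Gamma> e)"
    "label_letter (label \<Gamma> f) = letter_inv (label_letter (label \<Gamma> e))"
  shows "f = opposite \<Gamma> e"
proof -
  have l: "label \<Gamma> e \<in> Y \<union> (\<lambda>b. inv b) ` Y" "label \<Gamma> f \<in> Y \<union> (\<lambda>b. inv b) ` Y"
    and opp: "opposite \<Gamma> e \<in> edges \<Gamma>" "label \<Gamma> (opposite \<Gamma> e) = inv (label \<Gamma> e)"
    using assms by (auto simp: pointed_labeled_graph_def serre_graph_def)
  have "label \<Gamma> f = letter_eval G (letter_inv (label_letter (label \<Gamma> e)))"
    using label_letter(2)[OF l(2)] assms(6) by simp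
  also have "\<dots> = label \<Gamma> (opposite \<Gamma> e)"
    using label_letter[OF l(1)] basis_closed opp(2) by auto
  finally show ?thesis using assms opp(1) by (intro foldedD[OF assms(2)])
qed

lemma reduced_path_word:
  assumes "pointed_labeled_graph G Y \<Gamma>" "folded \<Gamma>" "is_path \<Gamma> u p v" "reduced_path \<Gamma> p"
  shows "reduced_word (path_word \<Gamma> p)"
  using assms(3,4)
proof (induction p arbitrary: u)
  case (Cons e p)
  then show ?case
  proof (cases p)
    case (Cons f q)
    have "label_letter (label \<Gamma> f) \<noteq> letter_inv (label_letter (label \<Gamma> e))"
      using opposite_eqI[OF assms(1,2), of e f] Cons.prems Cons by (auto simp: reduced_path_def)
    moreover have "reduced_word (path_word \<Gamma> p)"
      using Cons.prems by (intro Cons.IH) (auto simp: reduced_path_def successively_Cons)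
    ultimately show ?thesis by (simp add: Cons path_word_def)
  qed (simp add: path_word_def)
qed (simp add: path_word_def)

text \<open>Each cancelling pair of letters comes from an edge followed by its opposite, and
  deleting these two edges keeps the endpoints. Free reduction of the label is therefore followed by
  the path.\<close>

lemma reduced_representative:
  assumes "pointed_labeled_graph G Y \<Gamma>" "folded \<Gamma>" "is_path \<Gamma> u p v"
  shows "\<exists>q. is_path \<Gamma> u q v \<and> path_word \<Gamma> q = normal_word (path_label G \<Gamma> p)"
proof -
  have serre: "serre_graph \<Gamma>" using assms(1) by (simp add: pointed_labeled_graph_def)
  have "\<exists>q. is_path \<Gamma> u q v \<and> path_word \<Gamma> q = reduce_word (path_word \<Gamma> p)"
    using assms(3)
  proof (induction p arbitrary: u)
    case Nil
    then show ?case by (intro exI[of _ "[]"]) (auto simp: path_word_def reduce_word_def)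
  next
    case (Cons e p)
    then obtain q where q: "is_path \<Gamma> (origin \<Gamma> (opposite \<Gamma> e)) q v"
      "path_word \<Gamma> q = reduce_word (path_word \<Gamma> p)"
      by auto
    have red: "reduce_word (path_word \<Gamma> (e # p)) = push_letter (label_letter (label \<Gamma> e)) (path_word \<Gamma> q)"
      using q(2) by (simp add: path_word_def reduce_word_def)
    show ?case
    proof (cases "\<exists>f q'. q = f # q' \<and> label_letter (label \<Gamma> f) = letter_inv (label_letter (label \<Gamma> e))")
      case True
      then obtain f q' where f: "q = f # q'" "label_letter (label \<Gamma> f) = letter_inv (label_letter (label \<Gamma> e))"
        by blast
      then have "f = opposite \<Gamma> e"
        using q(1) Cons.prems by (intro opposite_eqI[OF assms(1,2)]) auto
      then have "is_path \<Gamma> u q' v"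
        using q(1) f(1) Cons.prems serre by (auto simp: serre_graph_def)
      then show ?thesis using f unfolding red by (intro exI[of _ q']) (simp add: path_word_def)
    next
      case False
      then have "path_word \<Gamma> (e # q) = reduce_word (path_word \<Gamma> (e # p))"
        unfolding red by (cases q) (auto simp: path_word_def)
      then show ?thesis using q(1) Cons.prems by (intro exI[of _ "e # q"]) simp
    qed
  qed
  moreover have "normal_word (path_label G \<Gamma> p) = reduce_word (path_word \<Gamma> p)"
  proof (rule normal_word_eqI)
    have p: "set p \<subseteq> edges \<Gamma>" using is_path_verts[OF serre assms(3)] by simp
    note w = path_word[OF assms(1) p]
    show "fst ` set (reduce_word (path_word \<Gamma> p)) \<subseteq> Y"
      using w(1) set_reduce[of "path_word \<Gamma> p"] by blast
    show "word_eval G (reduce_word (path_word \<Gamma> p)) = path_label G \<Gamma> p"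
      using w(1,2) basis_closed by (subst word_eval_reduce) auto
  qed (rule reduced_reduce)
  ultimately show ?thesis by simp
qed

section \<open>Edges of a core graph located in the Schreier graph\<close>

lemma path_label_append:
  assumes "pointed_labeled_graph G Y \<Gamma>" "set p \<subseteq> edges \<Gamma>" "set q \<subseteq> edges \<Gamma>"
  shows "path_label G \<Gamma> (p @ q) = path_label G \<Gamma> p \<otimes> path_label G \<Gamma> q"
proof -
  have "word_eval G (path_word \<Gamma> p @ path_word \<Gamma> q) = word_eval G (path_word \<Gamma> p) \<otimes> word_eval G (path_word \<Gamma> q)"
    using path_word(1)[OF assms(1,2)] path_word(1)[OF assms(1,3)] basis_closed
    by (intro word_eval_append) auto
  then show ?thesis
    using path_word(2)[OF assms(1), of "p @ q"] path_word(2)[OF assms(1,2)]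
      path_word(2)[OF assms(1,3)] assms(2,3) by (simp add: path_word_def)
qed

text \<open>The labels differ by a left factor in \<open>K\<close>, which is read by some loop at
  the base point. Prepending this loop to \<open>q\<close> makes the labels equal; after reduction
  both paths read the same word, and foldedness makes their ends agree.\<close>

lemma endpoint_determined_by_coset:
  assumes K: "subgroup K G" and \<Delta>: "stallings_graph G Y K \<Delta>"
    and p: "is_path \<Delta> (basepoint \<Delta>) p a" and q: "is_path \<Delta> (basepoint \<Delta>) q b"
    and eq: "K #> path_label G \<Delta> p = K #> path_label G \<Delta> q"
  shows "a = b"
proof -
  have plg: "pointed_labeled_graph G Y \<Delta>" and fold: "folded \<Delta>" and pi: "pi1 G \<Delta> = K"
    using \<Delta> by (auto simp: stallings_graph_def core_graph_def)
  then have serre: "serre_graph \<Delta>" by (simp add: pointed_labeled_graph_def)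
  have set: "set p \<subseteq> edges \<Delta>" "set q \<subseteq> edges \<Delta>" using is_path_verts[OF serre] p q by blast+
  note cl = path_word(3)[OF plg set(1)] path_word(3)[OF plg set(2)]
  have "path_label G \<Delta> p \<in> K #> path_label G \<Delta> q"
    using rcos_self[OF cl(1) K] eq by simp
  then obtain x where x: "x \<in> K" "path_label G \<Delta> p = x \<otimes> path_label G \<Delta> q"
    by (auto simp: r_coset_def)
  obtain r where r: "path_label G \<Delta> r = x" "is_path \<Delta> (basepoint \<Delta>) r (basepoint \<Delta>)"
    using x(1) unfolding pi[symmetric] by (auto simp: pi1_def)
  have "set r \<subseteq> edges \<Delta>" using is_path_verts[OF serre r(2)] by blast
  then have lab: "path_label G \<Delta> (r @ q) = path_label G \<Delta> p"
    using x(2) r(1) set(2) by (simp add: path_label_append[OF plg])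
  have rq: "is_path \<Delta> (basepoint \<Delta>) (r @ q) b" using r(2) q is_path_append_iff[OF serre] by blast
  obtain p' where p': "is_path \<Delta> (basepoint \<Delta>) p' a" "path_word \<Delta> p' = normal_word (path_label G \<Delta> p)"
    using reduced_representative[OF plg fold p] by blast
  obtain q' where q': "is_path \<Delta> (basepoint \<Delta>) q' b" "path_word \<Delta> q' = normal_word (path_label G \<Delta> p)"
    using reduced_representative[OF plg fold rq] lab by auto
  have "map (letter_eval G) (path_word \<Delta> s) = map (label \<Delta>) s" if s: "set s \<subseteq> edges \<Delta>" for s
    using s plg label_letter(2) by (auto simp: path_word_def pointed_labeled_graph_def)
  then have "map (label \<Delta>) p' = map (label \<Delta>) q'"
    using p' q' is_path_verts[OF serre] by metis
  then show ?thesis using folded_path_unique[OF fold p'(1) q'(1)] by blast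
qed

text \<open>Folded graphs embed into the Schreier graph, so an edge of \<open>\<Gamma>\<^sub>Y(K)\<close> is determined by the
  coset of its origin together with its label; hence it is hit as soon as a normal word from \<open>H\<close>
  traverses it in the Schreier graph.\<close>

lemma onto_if_trace_maximal:
  assumes K: "subgroup K G" and z: "z \<in> H" "\<And>x. x \<in> K \<Longrightarrow> trace K x \<subseteq> trace K z"
    and \<Gamma>: "stallings_graph G Y H \<Gamma>" and \<Delta>: "stallings_graph G Y K \<Delta>"
    and mor: "pl_morphism \<Gamma> \<Delta> \<phi> \<psi>"
  shows "onto_morphism \<Gamma> \<Delta> \<phi> \<psi>"
proof -
  have plg: "pointed_labeled_graph G Y \<Gamma>" "pointed_labeled_graph G Y \<Delta>"
    and fold: "folded \<Gamma>" "folded \<Delta>" and pi: "pi1 G \<Gamma> = H" "pi1 G \<Delta> = K"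
    and core: "connected_graph \<Delta>" "\<forall>e \<in> edges \<Delta>. \<exists>p. is_path \<Delta> (basepoint \<Delta>) p (basepoint \<Delta>) \<and>
        reduced_path \<Delta> p \<and> e \<in> set p"
    using \<Gamma> \<Delta> by (auto simp: stallings_graph_def core_graph_def)
  then have serre: "serre_graph \<Gamma>" "serre_graph \<Delta>" by (simp_all add: pointed_labeled_graph_def)
  note sub = subgroup.subset[OF K]
  have base: "\<phi> (basepoint \<Gamma>) = basepoint \<Delta>" using mor by (simp add: pl_morphism_def)
  \<comment> \<open>A loop reading \<open>z\<close> exists in the graph of \<open>H\<close>;
    reducing it gives a loop \<open>q\<close> whose word is the normal word of \<open>z\<close>, and
    its edges will be the preimages.\<close>
  obtain q0 where "path_label G \<Gamma> q0 = z" "is_path \<Gamma> (basepoint \<Gamma>) q0 (basepoint \<Gamma>)"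
    using z(1) unfolding pi(1)[symmetric] by (auto simp: pi1_def)
  then obtain q where q: "is_path \<Gamma> (basepoint \<Gamma>) q (basepoint \<Gamma>)" "path_word \<Gamma> q = normal_word z"
    using reduced_representative[OF plg(1) fold(1)] by blast
  have q_edges: "set q \<subseteq> edges \<Gamma>" using is_path_verts[OF serre(1) q(1)] by blast
  have E: "e \<in> \<psi> ` edges \<Gamma>" if e: "e \<in> edges \<Delta>" for e
  proof -
    obtain p where p: "is_path \<Delta> (basepoint \<Delta>) p (basepoint \<Delta>)" "reduced_path \<Delta> p" "e \<in> set p"
      using core(2) e by blast
    then obtain p1 p2 where p12: "p = p1 @ e # p2" by (meson split_list)
    have p_edges: "set p \<subseteq> edges \<Delta>" using is_path_verts[OF serre(2) p(1)] by blast
    then have p1_edges: "set p1 \<subseteq> edges \<Delta>" by (simp add: p12)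
    have p1: "is_path \<Delta> (basepoint \<Delta>) p1 (origin \<Delta> e)"
      using p(1) by (auto simp: p12 is_path_append_iff[OF serre(2)])
    define k where "k = path_label G \<Delta> p"
    have k: "k \<in> K" using p(1) pi(2) by (auto simp: k_def pi1_def)
    have le: "letter_eval G (label_letter (label \<Delta> e)) = label \<Delta> e"
      using plg(2) e label_letter(2) by (auto simp: pointed_labeled_graph_def)
    have nk: "normal_word k = path_word \<Delta> p"
      using path_word[OF plg(2) p_edges] reduced_path_word[OF plg(2) fold(2) p(1,2)]
      by (intro normal_word_eqI) (auto simp: k_def)
    have "(K #> path_label G \<Delta> p1, label \<Delta> e) \<in> set (coset_path G K (path_word \<Delta> p))"
    proof -
      have "path_word \<Delta> p = path_word \<Delta> p1 @ label_letter (label \<Delta> e) # path_word \<Delta> p2"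
        by (simp add: p12 path_word_def)
      moreover have "fst ` set (path_word \<Delta> p) \<subseteq> carrier G"
        using path_word(1)[OF plg(2) p_edges] basis_closed by blast
      ultimately show ?thesis
        using sub by (simp add: coset_path_append image_Un le path_word(2)[OF plg(2) p1_edges])
    qed
    \<comment> \<open>The reduced loop through \<open>e\<close> reads the normal word of an element
      of \<open>K\<close>, so maximality puts the Schreier edge of \<open>e\<close> into the trace
      of \<open>z\<close>.\<close>
    then have "(K #> path_label G \<Delta> p1, label \<Delta> e) \<in> trace K z"
      using z(2)[OF k] by (auto simp: coset_trace_def nk)
    then obtain d where d: "d \<in> set (coset_path G K (path_word \<Gamma> q))"
      "(K #> path_label G \<Delta> p1, label \<Delta> e) = d \<or> (K #> path_label G \<Delta> p1, label \<Delta> e) = coset_edge_opp G d"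
      by (auto simp: coset_trace_def q(2))
    have q_car: "fst ` set (path_word \<Gamma> q) \<subseteq> carrier G"
      using path_word(1)[OF plg(1) q_edges] basis_closed by blast
    obtain u y v where uyv: "path_word \<Gamma> q = u @ y # v" "d = (K #> word_eval G u, letter_eval G y)"
      using coset_path_split[OF sub q_car d(1)] by blast
    \<comment> \<open>The edge \<open>f\<close> of \<open>q\<close> that reads this letter is the
      candidate: \<open>e\<close> is its image, or the image of its opposite if \<open>z\<close>
      crosses the edge backwards.\<close>
    then obtain q1 f q2 where q12: "q = q1 @ f # q2" "u = path_word \<Gamma> q1" "y = label_letter (label \<Gamma> f)"
      by (auto simp: path_word_def map_eq_append_conv map_eq_Cons_conv)
    have f: "f \<in> edges \<Gamma>" and q1_edges: "set q1 \<subseteq> edges \<Gamma>" using q_edges by (auto simp: q12)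
    have \<psi>f: "\<psi> f \<in> edges \<Delta>" "label \<Delta> (\<psi> f) = label \<Gamma> f" "opposite \<Delta> (\<psi> f) = \<psi> (opposite \<Gamma> f)"
      using mor f by (auto simp: pl_morphism_def)
    have opp_f: "opposite \<Gamma> f \<in> edges \<Gamma>" using serre(1) f by (simp add: serre_graph_def)
    have "label \<Gamma> f \<in> Y \<union> (\<lambda>b. inv b) ` Y" using plg(1) f by (simp add: pointed_labeled_graph_def)
    from label_letter(2)[OF this] this
    have lf: "letter_eval G y = label \<Gamma> f" "label \<Gamma> f \<in> carrier G"
      using basis_closed by (auto simp: q12(3))
    have "is_path \<Gamma> (basepoint \<Gamma>) q1 (origin \<Gamma> f)"
      using q(1) by (auto simp: q12 is_path_append_iff[OF serre(1)])
    from pl_morphism_path[OF mor serre(1) this]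
    have i1: "is_path \<Delta> (basepoint \<Delta>) (map \<psi> q1) (origin \<Delta> (\<psi> f))"
      using mor f by (simp add: base pl_morphism_def)
    have l1: "path_label G \<Delta> (map \<psi> q1) = word_eval G u"
      by (simp add: pl_morphism_path_label[OF mor q1_edges] q12(2) path_word(2)[OF plg(1) q1_edges])
    from d(2) show ?thesis
    proof
      assume eq: "(K #> path_label G \<Delta> p1, label \<Delta> e) = d"
      then have "origin \<Delta> e = origin \<Delta> (\<psi> f)"
        using endpoint_determined_by_coset[OF K \<Delta> p1 i1] by (simp add: l1 uyv)
      moreover have "label \<Delta> e = label \<Delta> (\<psi> f)" using eq \<psi>f by (simp add: uyv lf)
      ultimately have "e = \<psi> f" using e \<psi>f by (intro foldedD[OF fold(2)])
      then show ?thesis using f by blast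
    next
      assume eq: "(K #> path_label G \<Delta> p1, label \<Delta> e) = coset_edge_opp G d"
      have opp: "opposite \<Delta> (\<psi> f) \<in> edges \<Delta>" "label \<Delta> (opposite \<Delta> (\<psi> f)) = inv (label \<Delta> (\<psi> f))"
        "origin \<Delta> (opposite \<Delta> (\<psi> f)) \<in> verts \<Delta>"
        using plg(2) \<psi>f(1) by (auto simp: pointed_labeled_graph_def serre_graph_def)
      have i2: "is_path \<Delta> (basepoint \<Delta>) (map \<psi> q1 @ [\<psi> f]) (origin \<Delta> (opposite \<Delta> (\<psi> f)))"
        using i1 \<psi>f(1) opp(3) by (auto simp: is_path_append_iff[OF serre(2)])
      have "set (map \<psi> q1) \<subseteq> edges \<Delta>" using is_path_verts[OF serre(2) i1] by blast
      then have "path_label G \<Delta> (map \<psi> q1 @ [\<psi> f]) = word_eval G u \<otimes> path_label G \<Delta> [\<psi> f]"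
        using \<psi>f(1) by (simp add: path_label_append[OF plg(2)] l1)
      then have l2: "path_label G \<Delta> (map \<psi> q1 @ [\<psi> f]) = word_eval G u \<otimes> label \<Gamma> f"
        using \<psi>f(2) lf(2) by (simp add: path_label_def)
      have "word_eval G u \<in> carrier G" using q_car by (simp add: uyv(1) image_Un)
      then have "K #> path_label G \<Delta> p1 = K #> path_label G \<Delta> (map \<psi> q1 @ [\<psi> f])"
        using eq sub lf by (simp add: uyv(2) coset_edge_opp_def coset_mult_assoc l2)
      then have "origin \<Delta> e = origin \<Delta> (opposite \<Delta> (\<psi> f))"
        using endpoint_determined_by_coset[OF K \<Delta> p1 i2] by blast
      moreover have "label \<Delta> e = label \<Delta> (opposite \<Delta> (\<psi> f))"
        using eq opp(2) \<psi>f(2) by (simp add: uyv(2) lf coset_edge_opp_def)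
      ultimately have "e = opposite \<Delta> (\<psi> f)" using e opp(1) by (intro foldedD[OF fold(2)])
      then show ?thesis using opp_f \<psi>f(3) by auto
    qed
  qed
  \<comment> \<open>A vertex reached from the base point by a nonempty path is the origin of the
    opposite of the last edge, so surjectivity on edges suffices.\<close>
  have V: "v \<in> \<phi> ` verts \<Gamma>" if v: "v \<in> verts \<Delta>" for v
  proof -
    have "basepoint \<Delta> \<in> verts \<Delta>" using plg(2) by (simp add: pointed_labeled_graph_def)
    then obtain p where p: "is_path \<Delta> (basepoint \<Delta>) p v"
      using core(1) v by (auto simp: connected_graph_def)
    show ?thesis
    proof (cases p rule: rev_cases)
      case Nil
      then show ?thesis using p base plg(1) by (auto simp: pointed_labeled_graph_def)
    next
      case (snoc p' e)
      then have e: "e \<in> edges \<Delta>" "v = origin \<Delta> (opposite \<Delta> e)"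
        using p by (auto simp: is_path_append_iff[OF serre(2)])
      then have "opposite \<Delta> e \<in> edges \<Delta>" using serre(2) by (simp add: serre_graph_def)
      then obtain f where "f \<in> edges \<Gamma>" "opposite \<Delta> e = \<psi> f" using E by blast
      then show ?thesis using e(2) mor serre(1) by (auto simp: pl_morphism_def serre_graph_def)
    qed
  qed
  show ?thesis using E V mor by (auto simp: onto_morphism_def pl_morphism_def)
qed

end

section \<open>Conjugating the basis\<close>

context group
begin

lemma word_eval_hom:
  assumes "B \<subseteq> carrier G"
  shows "word_eval G \<in> hom (free_group B) G"
proof (rule homI)
  fix u assume "u \<in> carrier (free_group B)"
  then show "word_eval G u \<in> carrier G" using assms by (auto simp: free_group_def)
next
  fix u v assume "u \<in> carrier (free_group B)" "v \<in> carrier (free_group B)"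
  then have *: "fst ` set u \<subseteq> carrier G" "fst ` set v \<subseteq> carrier G"
    using assms by (auto simp: free_group_def)
  then have "word_eval G (reduce_word (u @ v)) = word_eval G (u @ v)"
    by (intro word_eval_reduce) (simp add: image_Un)
  then show "word_eval G (u \<otimes>\<^bsub>free_group B\<^esub> v) = word_eval G u \<otimes> word_eval G v"
    using * by (simp add: word_eval_append free_group_def)
qed

definition conj_by :: "'a \<Rightarrow> 'a \<Rightarrow> 'a" where
  "conj_by g x = g \<otimes> x \<otimes> inv g"

lemma conj_by_closed [simp]: "g \<in> carrier G \<Longrightarrow> x \<in> carrier G \<Longrightarrow> conj_by g x \<in> carrier G"
  by (simp add: conj_by_def)

lemma conj_by_mult:
  "g \<in> carrier G \<Longrightarrow> x \<in> carrier G \<Longrightarrow> y \<in> carrier G \<Longrightarrow>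
     conj_by g (x \<otimes> y) = conj_by g x \<otimes> conj_by g y"
  by (simp add: conj_by_def m_assoc inv_solve_left' flip: m_assoc[of "inv g" g])

lemma conj_by_inv:
  "g \<in> carrier G \<Longrightarrow> x \<in> carrier G \<Longrightarrow> conj_by g (inv x) = inv (conj_by g x)"
  by (simp add: conj_by_def inv_mult_group m_assoc)

lemma conj_by_cancel:
  "g \<in> carrier G \<Longrightarrow> x \<in> carrier G \<Longrightarrow> conj_by g (conj_by (inv g) x) = x"
  "g \<in> carrier G \<Longrightarrow> x \<in> carrier G \<Longrightarrow> conj_by (inv g) (conj_by g x) = x"
  by (simp_all add: conj_by_def m_assoc[symmetric]) (simp_all add: m_assoc)

abbreviation conj_word :: "'a \<Rightarrow> 'a letter list \<Rightarrow> 'a letter list" where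
  "conj_word g \<equiv> map (apfst (conj_by g))"

lemma letter_eval_conj:
  "g \<in> carrier G \<Longrightarrow> fst x \<in> carrier G \<Longrightarrow> letter_eval G (apfst (conj_by g) x) = conj_by g (letter_eval G x)"
  by (simp add: letter_eval_def conj_by_inv)

lemma word_eval_conj:
  "g \<in> carrier G \<Longrightarrow> fst ` set w \<subseteq> carrier G \<Longrightarrow>
     word_eval G (conj_word g w) = conj_by g (word_eval G w)"
  by (induction w) (auto simp: letter_eval_conj conj_by_mult, simp add: conj_by_def)

lemma conj_word_cancel:
  "g \<in> carrier G \<Longrightarrow> fst ` set w \<subseteq> carrier G \<Longrightarrow> conj_word g (conj_word (inv g) w) = w"
  by (induction w) (auto simp: conj_by_cancel prod_eq_iff)

lemma reduced_conj_word:
  assumes "g \<in> carrier G" "fst ` set w \<subseteq> carrier G" "reduced_word w"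
  shows "reduced_word (conj_word g w)"
proof -
  have "apfst (conj_by g) y \<noteq> letter_inv (apfst (conj_by g) x)"
    if "y \<noteq> letter_inv x" "fst x \<in> carrier G" "fst y \<in> carrier G" for x y :: "'a letter"
    using that conj_by_cancel(2)[OF assms(1)] by (auto simp: letter_inv_def prod_eq_iff) metis+
  then show ?thesis
    using assms(2,3) unfolding reduced_word_def successively_map
    by (elim successively_mono) (simp add: image_subset_iff)
qed

text \<open>Translating cosets on the right by \<open>inv g\<close> while conjugating labels by
  \<open>g\<close> is an isomorphism of Schreier graphs, since \<open>inv g\<close> followed by the
  conjugate of \<open>l\<close> acts like \<open>l\<close> followed by \<open>inv g\<close>.\<close>

lemma coset_trace_conj:
  assumes "g \<in> carrier G" "C \<subseteq> carrier G" "fst ` set w \<subseteq> carrier G"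
  shows "coset_trace G (C #> inv g) (conj_word g w) =
    (\<lambda>(D, l). (D #> inv g, conj_by g l)) ` coset_trace G C w"
  using assms(2-)
proof (induction w arbitrary: C)
  case (Cons x w)
  have x: "letter_eval G x \<in> carrier G" using Cons.prems by simp
  have "C #> inv g #> conj_by g (letter_eval G x) = C #> letter_eval G x #> inv g"
    using assms(1) Cons.prems(1) x
    by (simp add: coset_mult_assoc conj_by_def) (simp add: m_assoc[symmetric])
  then show ?case
    using Cons x assms(1)
    by (simp add: letter_eval_conj coset_edge_opp_def r_coset_subset_G conj_by_inv)
qed simp

end

context based_group
begin

lemma conj_word_normal:
  assumes "g \<in> carrier G" "x \<in> carrier G"
  shows "fst ` set (conj_word g (normal_word x)) \<subseteq> conj_by g ` Y"
    "reduced_word (conj_word g (normal_word x))"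
    "word_eval G (conj_word g (normal_word x)) = conj_by g x"
  using normal_word[OF assms(2)] assms
  by (auto simp: word_eval_conj reduced_conj_word image_subset_iff)

lemma based_group_conj:
  assumes g: "g \<in> carrier G"
  shows "based_group G (conj_by g ` Y)"
proof
  have sub: "conj_by g ` Y \<subseteq> carrier G" using basis_closed g by auto
  have "inj_on (word_eval G) (carrier (free_group (conj_by g ` Y)))"
  proof (rule inj_onI)
    \<comment> \<open>Every reduced word over the conjugated basis is the letterwise conjugate of a
      reduced word over \<open>Y\<close>, which reduces injectivity to that for
      \<open>Y\<close>.\<close>
    have *: "\<exists>w'. w = conj_word g w' \<and> w' \<in> carrier (free_group Y)"
      if w: "w \<in> carrier (free_group (conj_by g ` Y))" for w
    proof (intro exI conjI)
      have w': "fst ` set w \<subseteq> conj_by g ` Y" "reduced_word w" using w by (auto simp: free_group_def)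
      then have wc: "fst ` set w \<subseteq> carrier G" using sub by blast
      show "w = conj_word g (conj_word (inv g) w)" by (simp only: conj_word_cancel[OF g wc])
      have "conj_by (inv g) ` conj_by g ` Y \<subseteq> Y"
        using conj_by_cancel(2)[OF g] basis_closed by (auto simp: subset_iff)
      then have "fst ` set (conj_word (inv g) w) \<subseteq> Y"
        using w'(1) by (fastforce simp: image_image)
      then show "conj_word (inv g) w \<in> carrier (free_group Y)"
        using reduced_conj_word[OF _ wc w'(2), of "inv g"] g by (simp add: carrier_free_group_iff)
    qed
    fix u v assume "u \<in> carrier (free_group (conj_by g ` Y))" "v \<in> carrier (free_group (conj_by g ` Y))"
      and eq: "word_eval G u = word_eval G v"
    then obtain u' v' where u': "u = conj_word g u'" "u' \<in> carrier (free_group Y)"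
      and v': "v = conj_word g v'" "v' \<in> carrier (free_group Y)" using * by meson
    then have c: "fst ` set u' \<subseteq> carrier G" "fst ` set v' \<subseteq> carrier G"
      using basis_closed by (auto simp: carrier_free_group_iff)
    have "conj_by g (word_eval G u') = conj_by g (word_eval G v')"
      using eq u'(1) v'(1) g c by (simp add: word_eval_conj)
    then have "word_eval G u' = word_eval G v'"
      using conj_by_cancel(2)[OF g] c by (metis word_eval_closed)
    then show "u = v"
      using bij_betw_word_eval u' v' by (auto simp: bij_betw_def dest: inj_onD)
  qed
  moreover have "word_eval G ` carrier (free_group (conj_by g ` Y)) = carrier G"
  proof
    show "word_eval G ` carrier (free_group (conj_by g ` Y)) \<subseteq> carrier G"
      using word_eval_hom[OF sub] by (auto simp: hom_def)
    show "carrier G \<subseteq> word_eval G ` carrier (free_group (conj_by g ` Y))"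
    proof
      fix x assume x: "x \<in> carrier G"
      then have i: "conj_by (inv g) x \<in> carrier G" using g by simp
      have "conj_word g (normal_word (conj_by (inv g) x)) \<in> carrier (free_group (conj_by g ` Y))"
        using conj_word_normal(1,2)[OF g i] by (simp add: free_group_def)
      moreover have "x = word_eval G (conj_word g (normal_word (conj_by (inv g) x)))"
        using conj_word_normal(3)[OF g i] conj_by_cancel(1)[OF g x] by simp
      ultimately show "x \<in> word_eval G ` carrier (free_group (conj_by g ` Y))" by blast
    qed
  qed
  ultimately show "free_basis G (conj_by g ` Y)"
    using sub word_eval_hom[OF sub] by (simp add: free_basis_def iso_def bij_betw_def)
qed

text \<open>As \<open>g\<close> lies in \<open>K\<close>, translation by \<open>inv g\<close> fixes
  the base coset. It therefore carries the trace of \<open>y\<close> over \<open>Y\<close> to that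
  of the conjugate of \<open>y\<close> over the conjugated basis, and inclusions of traces
  persist.\<close>

lemma trace_maximal_conj:
  assumes K: "subgroup K G" and g: "g \<in> K" and z: "z \<in> K"
    and max: "\<And>x. x \<in> K \<Longrightarrow> trace K x \<subseteq> trace K z" and x: "x \<in> K"
  shows "based_group.trace G (conj_by g ` Y) K x \<subseteq> based_group.trace G (conj_by g ` Y) K (conj_by g z)"
proof -
  note [simp] = subgroup.mem_carrier[OF K]
  interpret c: based_group G "conj_by g ` Y" using g by (intro based_group_conj) simp
  let ?s = "\<lambda>(D, l). (D #> inv g, conj_by g l)"
  have *: "coset_trace G K (c.normal_word (conj_by g y)) = ?s ` trace K y" if y: "y \<in> K" for y
  proof -
    have yg: "y \<in> carrier G" "g \<in> carrier G" using y g by simp_all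
    have "K #> inv g = K"
      using g K yg by (intro coset_join2) (simp_all add: subgroup.m_inv_closed)
    moreover have "c.normal_word (conj_by g y) = conj_word g (normal_word y)"
      using conj_word_normal[OF yg(2,1)] by (intro c.normal_word_eqI)
    ultimately show ?thesis
      using coset_trace_conj[OF yg(2) subgroup.subset[OF K] normal_word(3)[OF yg(1)]] by simp
  qed
  define y where "y = conj_by (inv g) x"
  have y: "y \<in> K" using K g x by (simp add: y_def conj_by_def subgroup.m_closed subgroup.m_inv_closed)
  have "x = conj_by g y" using g x by (simp add: y_def conj_by_cancel)
  then show ?thesis using *[OF y] *[OF z] max[OF y] by auto
qed

end

text \<open>The concrete graphs and morphism on cosets exhibit the objects in question; the last
  conjunct then treats every pair of representatives and every morphism between them.\<close>

theorem theorem21: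
  fixes F :: "('g, 'm) monoid_scheme" (structure)
    and Y H K :: "'g set"
  assumes "group F" and "free_basis F Y" and "finite Y"
    and "subgroup H F" and "subgroup K F" and "H \<subseteq> K"
    and "finitely_generated F H" and "finitely_generated F K"
    and nontrivial: "H = {\<one>} \<Longrightarrow> K = {\<one>}"
  shows "\<exists>B. free_basis F B \<and>
    (\<exists>g \<in> carrier F. B = (\<lambda>y. g \<otimes> y \<otimes> inv g) ` Y) \<and>
    (\<exists>(\<Gamma> :: ('g set, 'g set \<times> 'g, 'g) pl_graph) (\<Delta> :: ('g set, 'g set \<times> 'g, 'g) pl_graph) \<phi> \<psi>.
       stallings_graph F B H \<Gamma> \<and> stallings_graph F B K \<Delta> \<and> pl_morphism \<Gamma> \<Delta> \<phi> \<psi>) \<and>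
    (\<forall>(\<Gamma> :: ('v, 'e, 'g) pl_graph) (\<Delta> :: ('w, 'd, 'g) pl_graph) \<phi> \<psi>.
       stallings_graph F B H \<Gamma> \<and> stallings_graph F B K \<Delta> \<and> pl_morphism \<Gamma> \<Delta> \<phi> \<psi>
         \<longrightarrow> onto_morphism \<Gamma> \<Delta> \<phi> \<psi>)"
proof -
  interpret based_group F Y
    using assms(1,2) by (simp add: based_group_def based_group_axioms_def)
  note H = assms(4) and K = assms(5) and HK = assms(6)
  have "\<exists>g\<in>K. \<exists>h\<in>H. \<forall>x\<in>K. trace K x \<subseteq> trace K (g \<otimes> h \<otimes> inv g)"
  proof (cases "H = {\<one>}")
    case True
    \<comment> \<open>For trivial \<open>H\<close> the core graph is a single vertex over any basis
      and cannot cover a core graph with edges; \<open>nontrivial\<close> leaves only trivial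
      \<open>K\<close> here.\<close>
    then show ?thesis using nontrivial by simp
  next
    case False
    then obtain h where h: "h \<in> H" "h \<noteq> \<one>" using subgroup.one_closed[OF H] by blast
    obtain k where k: "k \<in> K" "\<forall>x\<in>K. trace K x \<subseteq> trace K k"
      using trace_maximum[OF K assms(8)] by blast
    obtain g i where "g \<in> K" "trace K k \<subseteq> trace K (g \<otimes> h [^] (i::nat) \<otimes> inv g)"
      using trace_conjugate[OF K k(1)] h HK by blast
    moreover have "h [^] i \<in> H" using trace_pow[OF H h(1)] by blast
    ultimately show ?thesis using k(2) by blast
  qed
  then obtain g h where g: "g \<in> K" and h: "h \<in> H"
    and max: "\<And>x. x \<in> K \<Longrightarrow> trace K x \<subseteq> trace K (g \<otimes> h \<otimes> inv g)" by blast
  have gc: "g \<in> carrier F" "inv g \<in> carrier F" and hc: "h \<in> carrier F"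
    using g h by (simp_all add: subgroup.mem_carrier[OF K] subgroup.mem_carrier[OF H])
  \<comment> \<open>Instead of replacing \<open>H\<close> by its conjugate under \<open>g\<close>,
    the basis is conjugated by \<open>inv g\<close>, which turns the element of maximal trace into
    \<open>h\<close>, an element of \<open>H\<close> itself.\<close>
  define B where "B = conj_by (inv g) ` Y"
  interpret B: based_group F B unfolding B_def by (rule based_group_conj[OF gc(2)])
  have ig: "inv g \<in> K" using g by (rule subgroup.m_inv_closed[OF K])
  have z: "g \<otimes> h \<otimes> inv g \<in> K" using g ig h HK by (auto intro!: subgroup.m_closed[OF K])
  have "conj_by (inv g) (g \<otimes> h \<otimes> inv g) = h"
    using conj_by_cancel(2)[OF gc(1) hc] by (simp add: conj_by_def)
  then have maxB: "B.trace K x \<subseteq> B.trace K h" if x: "x \<in> K" for x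
    using trace_maximal_conj[OF K ig z max x] by (simp add: B_def)
  show ?thesis
  proof (intro exI[of _ B] conjI allI impI)
    show "\<exists>g \<in> carrier F. B = (\<lambda>y. g \<otimes> y \<otimes> inv g) ` Y"
      using gc(2) by (auto simp: B_def conj_by_def intro!: bexI[of _ "inv g"])
    show "\<exists>(\<Gamma> :: ('g set, 'g set \<times> 'g, 'g) pl_graph) (\<Delta> :: ('g set, 'g set \<times> 'g, 'g) pl_graph) \<phi> \<psi>.
       stallings_graph F B H \<Gamma> \<and> stallings_graph F B K \<Delta> \<and> pl_morphism \<Gamma> \<Delta> \<phi> \<psi>"
      using B.stallings_graph_core[OF H] B.stallings_graph_core[OF K] B.core_morphism[OF H K HK] by blast
  qed (use B.onto_if_trace_maximal[OF K h maxB] B.basis in blast)+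
qed

end
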